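(* Assume the linear model $Y_i=\beta^TX_i+\epsilon_i$, $i=1,\dots,n$, described in the context, with $X_i\overset{i.i.d.}{\sim}N(\mathbf{0},\mathbf{I})$ and $\epsilon_1,\dots,\epsilon_n\sim N(0,\sigma^2)$, and assume that $\tau^2+\sigma^2$ is bounded and $p/n$ converges to a constant. Then $$\sqrt n\left(\frac{\hat\tau^2-\tau^2}{\psi}\right)\overset{D}{\rightarrow}N(0,1),$$ where $\psi>0$ is given by $\psi^2=2\left\{\left(1+\frac pn\right)(\sigma^2+\tau^2)^2-\sigma^4+3\tau^4\right\}$.
   Context: Setting. $(X_1,Y_1),\dots,(X_n,Y_n)$ are i.i.d. with $X_i\in\mathbb{R}^p$, $Y_i=\beta^TX_i+\epsilon_i$, $E(\epsilon_i|X_i)=0$, $E(\epsilon_i^2|X_i)=\sigma^2$, $E(X_i)=0$, $\mathrm{Cov}(X_i)=\mathbf{I}$. The signal level is $\tau^2=\|\beta\|^2$. Limits are taken as $n$ and $p=p_n$ go together to $\infty$. With $W_{ij}=X_{ij}Y_i$ and $W_i=(W_{i1},\dots,W_{ip})^T$, the naive estimator is $\hat\tau^2=\binom n2^{-1}\sum_{i_1<i_2}W_{i_1}^TW_{i_2}$. *)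

theory Defs
  imports "HOL-Probability.Probability"
begin

text \<open>Observations are indexed by \<open>i < n\<close> and coordinates by \<open>j < p\<close>. A vector in \<open>\<real>\<^sup>p\<close> is a
  function \<open>nat \<Rightarrow> real\<close> of which only the values below \<open>p\<close> matter; as a random element it lives in
  the product space below, because the dimension has to vary with the sample size.\<close>

abbreviation vec_space :: "nat \<Rightarrow> (nat \<Rightarrow> real) measure" where
  "vec_space p \<equiv> PiM {..<p} (\<lambda>_. borel)"

definition covariates :: "nat \<Rightarrow> (nat \<Rightarrow> nat \<Rightarrow> 'a \<Rightarrow> real) \<Rightarrow> nat \<Rightarrow> 'a \<Rightarrow> (nat \<Rightarrow> real)" where
  "covariates p X i = (\<lambda>\<omega>. \<lambda>j\<in>{..<p}. X i j \<omega>)"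

definition signal :: "nat \<Rightarrow> (nat \<Rightarrow> real) \<Rightarrow> real" where
  "signal p \<beta> = (\<Sum>j<p. (\<beta> j)\<^sup>2)"

text \<open>\<open>N(0, \<sigma>\<^sup>2)\<close>; for \<open>\<sigma> = 0\<close> it is the point mass at 0, whereas \<^const>\<open>normal_density\<close>
  requires \<open>\<sigma> > 0\<close> to be a probability density.\<close>

definition normal_law :: "real \<Rightarrow> real measure" where
  "normal_law \<sigma> = (if \<sigma> = 0 then return borel 0
                    else density lborel (\<lambda>x. ennreal (normal_density 0 \<sigma> x)))"

text \<open>\<open>N(0, I)\<close> on \<open>\<real>\<^sup>p\<close>: independent standard normal coordinates.\<close>

definition std_normal_vec :: "nat \<Rightarrow> (nat \<Rightarrow> real) measure" where
  "std_normal_vec p = PiM {..<p} (\<lambda>_. std_normal_distribution)"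

text \<open>The errors are only required to satisfy the two conditional moment conditions given the
  covariates; they need not be independent of them.\<close>

locale linear_model = prob_space M
  for M :: "'a measure" +
  fixes n p :: nat
    and X :: "nat \<Rightarrow> nat \<Rightarrow> 'a \<Rightarrow> real"
    and Y \<epsilon> :: "nat \<Rightarrow> 'a \<Rightarrow> real"
    and \<beta> :: "nat \<Rightarrow> real"
    and \<sigma> :: real
  assumes sigma_nonneg: "\<sigma> \<ge> 0"
    and model: "\<And>i \<omega>. i < n \<Longrightarrow> \<omega> \<in> space M \<Longrightarrow> Y i \<omega> = (\<Sum>j<p. \<beta> j * X i j \<omega>) + \<epsilon> i \<omega>"
    and indep: "indep_vars (\<lambda>_. vec_space p \<Otimes>\<^sub>M borel) (\<lambda>i \<omega>. (covariates p X i \<omega>, Y i \<omega>)) {..<n}"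
    and identically_distributed: "\<And>i k. i < n \<Longrightarrow> k < n \<Longrightarrow>
      distr M (vec_space p \<Otimes>\<^sub>M borel) (\<lambda>\<omega>. (covariates p X i \<omega>, Y i \<omega>)) =
      distr M (vec_space p \<Otimes>\<^sub>M borel) (\<lambda>\<omega>. (covariates p X k \<omega>, Y k \<omega>))"
    and X_square_integrable: "\<And>i j. i < n \<Longrightarrow> j < p \<Longrightarrow> integrable M (\<lambda>\<omega>. (X i j \<omega>)\<^sup>2)"
    and X_mean: "\<And>i j. i < n \<Longrightarrow> j < p \<Longrightarrow> expectation (X i j) = 0"
    and X_cov: "\<And>i j k. i < n \<Longrightarrow> j < p \<Longrightarrow> k < p \<Longrightarrow>
      expectation (\<lambda>\<omega>. (X i j \<omega> - expectation (X i j)) * (X i k \<omega> - expectation (X i k))) =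
      (if j = k then 1 else 0)"
    and error_square_integrable: "\<And>i. i < n \<Longrightarrow> integrable M (\<lambda>\<omega>. (\<epsilon> i \<omega>)\<^sup>2)"
    and error_mean: "\<And>i. i < n \<Longrightarrow>
      AE \<omega> in M. real_cond_exp M (vimage_algebra (space M) (covariates p X i) (vec_space p)) (\<epsilon> i) \<omega> = 0"
    and error_variance: "\<And>i. i < n \<Longrightarrow>
      AE \<omega> in M. real_cond_exp M (vimage_algebra (space M) (covariates p X i) (vec_space p))
        (\<lambda>\<omega>. (\<epsilon> i \<omega>)\<^sup>2) \<omega> = \<sigma>\<^sup>2"

definition naive_estimator ::
    "nat \<Rightarrow> nat \<Rightarrow> (nat \<Rightarrow> nat \<Rightarrow> 'a \<Rightarrow> real) \<Rightarrow> (nat \<Rightarrow> 'a \<Rightarrow> real) \<Rightarrow> 'a \<Rightarrow> real" where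
  "naive_estimator n p X Y \<omega> =
     (let W = (\<lambda>i j. X i j \<omega> * Y i \<omega>)
      in (\<Sum>i\<^sub>2<n. \<Sum>i\<^sub>1<i\<^sub>2. \<Sum>j<p. W i\<^sub>1 j * W i\<^sub>2 j) / real (n choose 2))"

end

theory Submission
  imports Defs
begin

text \<open>
  Let \<open>w\<^sub>i = X\<^sub>i Y\<^sub>i - \<beta>\<close> be the centred score of observation \<open>i\<close>, and write \<open>t\<close> for the signal level
  \<open>\<beta>\<^sup>T \<beta>\<close> and \<open>s = \<sigma>\<^sup>2 + t\<close>. Expanding \<open>(w\<^sub>a + \<beta>)\<^sup>T (w\<^sub>b + \<beta>)\<close> over all pairs shows that the standardised
  estimation error is a sum \<open>D\<^sub>0 + \<dots> + D\<^sub>n\<^sub>-\<^sub>1\<close> with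
  \<open>D\<^sub>b = \<kappa> w\<^sub>b\<^sup>T (w\<^sub>0 + \<dots> + w\<^sub>b\<^sub>-\<^sub>1 + (n - 1) \<beta>)\<close> and \<open>\<kappa> = 2 / (\<surd>n (n - 1) \<psi>)\<close>. The bracket depends only on
  earlier observations and \<open>w\<^sub>b\<close> is centred and independent of them, so the \<open>D\<^sub>b\<close> are martingale
  differences. The drift \<open>(n - 1) \<beta>\<close> produces the part of \<open>\<psi>\<^sup>2\<close> that stems from the signal, and the random
  walk of the \<open>w\<^sub>a\<close>, whose squared length grows like \<open>s p\<close> per step, produces the part with \<open>p / n\<close>.

  What makes a short proof possible is that every single conditional variance \<open>V\<^sub>b\<close> of \<open>D\<^sub>b\<close>, and not only
  their sum, is close to a deterministic number \<open>v\<^sub>b\<close>: in \<open>L\<^sup>1\<close> the distance is of order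
  \<open>(1 / \<surd>p + 1 / \<surd>n) / n\<close>, because the squared length of a sum of high-dimensional independent vectors
  concentrates. Hence characteristic functions can be peeled off one increment at a time:
  a second-order expansion of \<open>exp (i u D\<^sub>b)\<close>, in which the linear term vanishes and the quadratic
  term may be replaced by \<open>v\<^sub>b\<close>, shows that each step multiplies the characteristic function by
  \<open>exp (- u\<^sup>2 v\<^sub>b / 2)\<close> up to a small error. This is \<open>char_sum_near_normal\<close>; no stopping time and no random
  normalisation are involved. The \<open>v\<^sub>b\<close> add up to \<open>1 + O(1 / n)\<close>, and the third moments are of order
  \<open>n\<close> to the power \<open>- 3 / 2\<close>, so the total error is of order \<open>1 / \<surd>p + 1 / \<surd>n\<close> for fixed \<open>u\<close>
  (\<open>char_near_normal\<close>), and Levy's continuity theorem finishes the proof.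

  The independent scores enter through three moments of \<open>x\<^sup>T w\<^sub>i\<close> for fixed vectors \<open>x\<close>: it is centred,
  it has variance \<open>s x\<^sup>T x + (x\<^sup>T \<beta>)\<^sup>2\<close>, and its fourth moment is at most a constant times
  \<open>s\<^sup>2 (x\<^sup>T x)\<^sup>2\<close>. The locale \<open>score_sample\<close> isolates these. The variance depends on
  the errors only through their first two conditional moments given the covariates, and the fourth moment is
  controlled by the marginal laws alone through the inequality of the arithmetic and geometric mean; this is
  why errors that are dependent on the covariates cause no difficulty. The Gaussian covariates enter
  through the moments of \<open>x\<^sup>T X\<^sub>i\<close>, from which mixed moments follow by polarisation.
\<close>

section \<open>Characteristic functions of martingale sums\<close>

text \<open>Independence in the form in which it is used throughout: a function of two independent random elements
  may be integrated over the second one with the first one frozen. It takes the place of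
  conditional expectations given the past.\<close>

lemma (in prob_space) indep_var_integral_iterated:
  fixes f :: "'b \<times> 'b \<Rightarrow> 'd::{banach, second_countable_topology}"
  assumes indep: "indep_var N U L Z"
    and f[measurable]: "f \<in> borel_measurable (N \<Otimes>\<^sub>M L)"
    and int: "integrable M (\<lambda>\<omega>. f (U \<omega>, Z \<omega>))"
  shows "(\<integral>\<omega>. f (U \<omega>, Z \<omega>) \<partial>M) = (\<integral>\<omega>. (\<integral>\<omega>'. f (U \<omega>, Z \<omega>') \<partial>M) \<partial>M)"
proof -
  have U[measurable]: "U \<in> measurable M N" and Z[measurable]: "Z \<in> measurable M L"
    and eq: "distr M N U \<Otimes>\<^sub>M distr M L Z = distr M (N \<Otimes>\<^sub>M L) (\<lambda>\<omega>. (U \<omega>, Z \<omega>))"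
    using indep by (auto simp: indep_var_distribution_eq)
  interpret U: prob_space "distr M N U" by (rule prob_space_distr) fact
  interpret Z: prob_space "distr M L Z" by (rule prob_space_distr) fact
  interpret UZ: pair_sigma_finite "distr M N U" "distr M L Z" ..
  have "integrable (distr M (N \<Otimes>\<^sub>M L) (\<lambda>\<omega>. (U \<omega>, Z \<omega>))) f"
    using int by (subst integrable_distr_eq) auto
  then have i: "integrable (distr M N U \<Otimes>\<^sub>M distr M L Z) f" by (simp add: eq)
  have "(\<integral>\<omega>. f (U \<omega>, Z \<omega>) \<partial>M) = integral\<^sup>L (distr M (N \<Otimes>\<^sub>M L) (\<lambda>\<omega>. (U \<omega>, Z \<omega>))) f"
    by (subst integral_distr) auto
  also have "\<dots> = (\<integral>x. (\<integral>y. f (x, y) \<partial>distr M L Z) \<partial>distr M N U)"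
    using UZ.integral_fst'[OF i] by (simp add: eq)
  also have "\<dots> = (\<integral>\<omega>. (\<integral>y. f (U \<omega>, y) \<partial>distr M L Z) \<partial>M)"
    by (subst integral_distr) auto
  also have "\<dots> = (\<integral>\<omega>. (\<integral>\<omega>'. f (U \<omega>, Z \<omega>') \<partial>M) \<partial>M)"
    by (intro Bochner_Integration.integral_cong refl, subst integral_distr) (auto dest: measurable_space[OF U])
  finally show ?thesis .
qed

lemma (in prob_space) indep_var_nn_integral_iterated:
  assumes indep: "indep_var N U L Z"
    and f[measurable]: "f \<in> borel_measurable (N \<Otimes>\<^sub>M L)"
  shows "(\<integral>\<^sup>+\<omega>. f (U \<omega>, Z \<omega>) \<partial>M) = (\<integral>\<^sup>+\<omega>. (\<integral>\<^sup>+\<omega>'. f (U \<omega>, Z \<omega>') \<partial>M) \<partial>M)"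
proof -
  have U[measurable]: "U \<in> measurable M N" and Z[measurable]: "Z \<in> measurable M L"
    and eq: "distr M N U \<Otimes>\<^sub>M distr M L Z = distr M (N \<Otimes>\<^sub>M L) (\<lambda>\<omega>. (U \<omega>, Z \<omega>))"
    using indep by (auto simp: indep_var_distribution_eq)
  interpret Z: prob_space "distr M L Z" by (rule prob_space_distr) fact
  have "(\<integral>\<^sup>+\<omega>. f (U \<omega>, Z \<omega>) \<partial>M) = integral\<^sup>N (distr M (N \<Otimes>\<^sub>M L) (\<lambda>\<omega>. (U \<omega>, Z \<omega>))) f"
    by (subst nn_integral_distr) auto
  also have "\<dots> = (\<integral>\<^sup>+x. (\<integral>\<^sup>+y. f (x, y) \<partial>distr M L Z) \<partial>distr M N U)"
    using Z.nn_integral_fst[of f "distr M N U"] by (simp add: eq)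
  also have "\<dots> = (\<integral>\<^sup>+\<omega>. (\<integral>\<^sup>+y. f (U \<omega>, y) \<partial>distr M L Z) \<partial>M)"
    by (subst nn_integral_distr) auto
  also have "\<dots> = (\<integral>\<^sup>+\<omega>. (\<integral>\<^sup>+\<omega>'. f (U \<omega>, Z \<omega>') \<partial>M) \<partial>M)"
    by (intro nn_integral_cong, subst nn_integral_distr) (auto dest: measurable_space[OF U])
  finally show ?thesis .
qed

lemma exp_neg_linear_error:
  fixes x :: real
  assumes "0 \<le> x"
  shows "\<bar>1 - x - exp (- x)\<bar> \<le> x\<^sup>2 / 2"
proof -
  have a: "1 - x \<le> exp (- x)" using exp_ge_add_one_self[of "-x"] by simp
  have "exp (-x) \<le> 1 - x + x\<^sup>2 / 2"
  proof -
    have "(\<lambda>y. 1 - y + y\<^sup>2/2 - exp (-y)) 0 \<le> (\<lambda>y. 1 - y + y\<^sup>2/2 - exp (-y)) x"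
    proof (rule DERIV_nonneg_imp_nondecreasing[OF assms])
      fix y :: real assume "0 \<le> y" "y \<le> x"
      have "((\<lambda>y. 1 - y + y\<^sup>2/2 - exp (-y)) has_real_derivative (-1 + y + exp (-y))) (at y)"
        by (auto intro!: derivative_eq_intros)
      moreover have "0 \<le> -1 + y + exp (-y)" using exp_ge_add_one_self[of "-y"] by simp
      ultimately show "\<exists>d. ((\<lambda>y. 1 - y + y\<^sup>2/2 - exp (-y)) has_real_derivative d) (at y) \<and> 0 \<le> d" by blast
    qed
    then show ?thesis by simp
  qed
  with a show ?thesis by simp
qed

lemma exp_neg_contraction:
  fixes a b :: real
  assumes "0 \<le> a" "0 \<le> b"
  shows "\<bar>exp (- a) - exp (- b)\<bar> \<le> \<bar>a - b\<bar>"
proof -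
  have le: "\<bar>exp (- a) - exp (- b)\<bar> \<le> b - a" if "0 \<le> a" "a \<le> b" for a b :: real
  proof -
    have "1 - exp (- (b - a)) \<le> b - a"
      using exp_ge_add_one_self[of "- (b - a)"] by linarith
    then have "exp (- a) * (1 - exp (- (b - a))) \<le> 1 * (b - a)"
      using that by (intro mult_mono) auto
    then show ?thesis using that by (simp add: right_diff_distrib exp_add[symmetric])
  qed
  show ?thesis
    using le[of a b] le[of b a] assms by (cases "a \<le> b") (auto simp: abs_minus_commute)
qed

lemma iexp_quadratic_error:
  "cmod (iexp x - (1 + \<i> * of_real x - of_real (x\<^sup>2) / 2)) \<le> \<bar>x\<bar> ^ 3 / 6"
proof -
  have "(\<Sum>k\<le>2. (\<i> * complex_of_real x) ^ k / fact k) = 1 + \<i> * of_real x - of_real (x\<^sup>2) / 2"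
  proof -
    have "{..2::nat} = {0, 1, 2}" by auto
    then show ?thesis by (simp add: power_mult_distrib)
  qed
  with iexp_approx1[of x 2] show ?thesis by (simp add: fact_numeral)
qed

text \<open>Put \<open>\<phi>\<^sub>k = E exp (i u (D\<^sub>0 + \<dots> + D\<^sub>k\<^sub>-\<^sub>1))\<close>. Expanding the last factor of \<open>\<phi>\<^sub>k\<^sub>+\<^sub>1\<close> to second
  order, the linear term vanishes by \<open>mean\<close>, the quadratic one is \<open>- (u\<^sup>2 / 2) v\<^sub>k \<phi>\<^sub>k\<close> up to
  \<open>(u\<^sup>2 / 2) \<delta>\<^sub>k\<close> by \<open>var\<close>, and the remainder is controlled by the third moment, so \<open>\<phi>\<^sub>k\<^sub>+\<^sub>1\<close> is
  nearly \<open>exp (- u\<^sup>2 v\<^sub>k / 2) \<phi>\<^sub>k\<close>. The errors simply add up because the factors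
  \<open>exp (- u\<^sup>2 v\<^sub>k / 2)\<close> are at most 1. The two conditions on \<open>D\<close> are weaker than statements about conditional
  expectations: they concern the single test function \<open>exp (i u (D\<^sub>0 + \<dots> + D\<^sub>k\<^sub>-\<^sub>1))\<close>.\<close>

lemma (in prob_space) char_sum_near_normal:
  fixes D :: "nat \<Rightarrow> 'a \<Rightarrow> real" and v \<delta> \<eta> :: "nat \<Rightarrow> real" and u :: real
  assumes D[measurable]: "\<And>i. i < n \<Longrightarrow> D i \<in> borel_measurable M"
    and D2: "\<And>i. i < n \<Longrightarrow> integrable M (\<lambda>\<omega>. (D i \<omega>)\<^sup>2)"
    and D3: "\<And>i. i < n \<Longrightarrow> integrable M (\<lambda>\<omega>. \<bar>D i \<omega>\<bar> ^ 3)"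
    and v: "\<And>i. i < n \<Longrightarrow> 0 \<le> v i"
    and mean: "\<And>i. i < n \<Longrightarrow> expectation (\<lambda>\<omega>. D i \<omega> *\<^sub>R iexp (u * (\<Sum>k<i. D k \<omega>))) = 0"
    and var: "\<And>i. i < n \<Longrightarrow>
      cmod (expectation (\<lambda>\<omega>. ((D i \<omega>)\<^sup>2 - v i) *\<^sub>R iexp (u * (\<Sum>k<i. D k \<omega>)))) \<le> \<delta> i"
    and third: "\<And>i. i < n \<Longrightarrow> expectation (\<lambda>\<omega>. \<bar>D i \<omega>\<bar> ^ 3) \<le> \<eta> i"
  shows "cmod (expectation (\<lambda>\<omega>. iexp (u * (\<Sum>i<n. D i \<omega>))) - of_real (exp (- (u\<^sup>2 / 2) * (\<Sum>i<n. v i))))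
    \<le> (\<Sum>i<n. u\<^sup>2 / 2 * \<delta> i + \<bar>u\<bar> ^ 3 / 6 * \<eta> i + u ^ 4 / 8 * (v i)\<^sup>2)"
proof -
  define E where "E k \<omega> = iexp (u * (\<Sum>i<k. D i \<omega>))" for k \<omega>
  define \<phi> where "\<phi> k = expectation (E k)" for k
  have E_m[measurable]: "E k \<in> borel_measurable M" if "k \<le> n" for k
    unfolding E_def by measurable (use that in auto)
  have E_norm: "cmod (E k \<omega>) = 1" for k \<omega> by (simp add: E_def)
  have E_int: "integrable M (\<lambda>\<omega>. f \<omega> *\<^sub>R E k \<omega>)" if "integrable M f" "k \<le> n" for f :: "'a \<Rightarrow> real" and k
  proof (rule Bochner_Integration.integrable_bound[OF that(1)])
    show "(\<lambda>\<omega>. f \<omega> *\<^sub>R E k \<omega>) \<in> borel_measurable M" using that by measurable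
  qed (simp add: E_norm)
  have \<phi>_le: "cmod (\<phi> k) \<le> 1" if "k \<le> n" for k
  proof -
    have "cmod (\<phi> k) \<le> expectation (\<lambda>\<omega>. cmod (E k \<omega>))"
      unfolding \<phi>_def by (rule integral_norm_bound)
    then show ?thesis by (simp add: E_norm prob_space)
  qed
  have step: "cmod (\<phi> (Suc k) - of_real (exp (- (u\<^sup>2 / 2) * v k)) * \<phi> k)
      \<le> u\<^sup>2 / 2 * \<delta> k + \<bar>u\<bar> ^ 3 / 6 * \<eta> k + u ^ 4 / 8 * (v k)\<^sup>2" if k: "k < n" for k
  proof -
    have [measurable]: "D k \<in> borel_measurable M" "E k \<in> borel_measurable M" using k by auto
    define R where "R \<omega> = iexp (u * D k \<omega>) - (1 + \<i> * of_real (u * D k \<omega>) - of_real ((u * D k \<omega>)\<^sup>2) / 2)" for \<omega>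
    have R_m[measurable]: "R \<in> borel_measurable M" unfolding R_def by measurable
    have R_le: "cmod (R \<omega> * E k \<omega>) \<le> \<bar>u\<bar> ^ 3 / 6 * \<bar>D k \<omega>\<bar> ^ 3" for \<omega>
      using iexp_quadratic_error[of "u * D k \<omega>"]
      by (simp add: norm_mult E_norm R_def abs_mult power_mult_distrib)
    have R_int: "integrable M (\<lambda>\<omega>. R \<omega> * E k \<omega>)"
      by (rule Bochner_Integration.integrable_bound[of _ "\<lambda>\<omega>. \<bar>u\<bar> ^ 3 / 6 * \<bar>D k \<omega>\<bar> ^ 3"])
        (use D3[OF k] R_le in \<open>auto intro!: AE_I2\<close>)
    have D1: "integrable M (D k)"
      by (rule square_integrable_imp_integrable) (use D2[OF k] in auto)
    have c0: "E (Suc k) \<omega> = of_real (1 - u\<^sup>2 / 2 * v k) * E k \<omega> + (\<i> * u) * (D k \<omega> *\<^sub>R E k \<omega>)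
        - of_real (u\<^sup>2 / 2) * (((D k \<omega>)\<^sup>2 - v k) *\<^sub>R E k \<omega>) + R \<omega> * E k \<omega>" for \<omega>
    proof -
      have "E (Suc k) \<omega> = iexp (u * D k \<omega>) * E k \<omega>"
        by (simp add: E_def exp_add[symmetric] algebra_simps)
      also have "iexp (u * D k \<omega>) = 1 + \<i> * of_real (u * D k \<omega>) - of_real ((u * D k \<omega>)\<^sup>2) / 2 + R \<omega>"
        by (simp add: R_def)
      finally show ?thesis
        by (simp add: scaleR_conv_of_real algebra_simps power_mult_distrib)
    qed
    have i0: "integrable M (E k)" using E_int[of "\<lambda>_. 1" k] k by simp
    have i1: "integrable M (\<lambda>\<omega>. D k \<omega> *\<^sub>R E k \<omega>)" using E_int[OF D1] k by simp
    have i2: "integrable M (\<lambda>\<omega>. ((D k \<omega>)\<^sup>2 - v k) *\<^sub>R E k \<omega>)" using D2[OF k] k by (intro E_int) auto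
    have j0: "integrable M (\<lambda>\<omega>. of_real (1 - u\<^sup>2 / 2 * v k) * E k \<omega>)"
      by (rule integrable_mult_right[OF i0])
    have j1: "integrable M (\<lambda>\<omega>. (\<i> * u) * (D k \<omega> *\<^sub>R E k \<omega>))"
      by (rule integrable_mult_right[OF i1])
    have j2: "integrable M (\<lambda>\<omega>. of_real (u\<^sup>2 / 2) * (((D k \<omega>)\<^sup>2 - v k) *\<^sub>R E k \<omega>))"
      by (rule integrable_mult_right[OF i2])
    have "\<phi> (Suc k) = expectation (\<lambda>\<omega>. of_real (1 - u\<^sup>2 / 2 * v k) * E k \<omega> + (\<i> * u) * (D k \<omega> *\<^sub>R E k \<omega>)
        - of_real (u\<^sup>2 / 2) * (((D k \<omega>)\<^sup>2 - v k) *\<^sub>R E k \<omega>) + R \<omega> * E k \<omega>)"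
      unfolding \<phi>_def c0 ..
    also have "\<dots> = expectation (\<lambda>\<omega>. of_real (1 - u\<^sup>2 / 2 * v k) * E k \<omega>) + expectation (\<lambda>\<omega>. (\<i> * u) * (D k \<omega> *\<^sub>R E k \<omega>))
        - expectation (\<lambda>\<omega>. of_real (u\<^sup>2 / 2) * (((D k \<omega>)\<^sup>2 - v k) *\<^sub>R E k \<omega>)) + expectation (\<lambda>\<omega>. R \<omega> * E k \<omega>)"
      by (simp only: Bochner_Integration.integral_add Bochner_Integration.integral_diff Bochner_Integration.integrable_add Bochner_Integration.integrable_diff j0 j1 j2 R_int)
    also have "\<dots> = of_real (1 - u\<^sup>2 / 2 * v k) * \<phi> k + (\<i> * u) * expectation (\<lambda>\<omega>. D k \<omega> *\<^sub>R E k \<omega>)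
        - of_real (u\<^sup>2 / 2) * expectation (\<lambda>\<omega>. ((D k \<omega>)\<^sup>2 - v k) *\<^sub>R E k \<omega>) + expectation (\<lambda>\<omega>. R \<omega> * E k \<omega>)"
      unfolding \<phi>_def by (simp only: integral_mult_right_zero)
    finally have \<phi>_Suc: "\<phi> (Suc k) = of_real (1 - u\<^sup>2 / 2 * v k) * \<phi> k 
        - of_real (u\<^sup>2 / 2) * expectation (\<lambda>\<omega>. ((D k \<omega>)\<^sup>2 - v k) *\<^sub>R E k \<omega>) + expectation (\<lambda>\<omega>. R \<omega> * E k \<omega>)"
      using mean[OF k] unfolding E_def by simp
    have "cmod (expectation (\<lambda>\<omega>. R \<omega> * E k \<omega>)) \<le> expectation (\<lambda>\<omega>. \<bar>u\<bar> ^ 3 / 6 * \<bar>D k \<omega>\<bar> ^ 3)"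
      by (rule order_trans[OF integral_norm_bound], rule integral_mono)
        (use R_int D3[OF k] R_le in auto)
    also have "\<dots> \<le> \<bar>u\<bar> ^ 3 / 6 * \<eta> k"
      using third[OF k] by (simp add: mult_left_mono)
    finally have e1: "cmod (expectation (\<lambda>\<omega>. R \<omega> * E k \<omega>)) \<le> \<bar>u\<bar> ^ 3 / 6 * \<eta> k" .
    have e2: "cmod (of_real (u\<^sup>2 / 2) * expectation (\<lambda>\<omega>. ((D k \<omega>)\<^sup>2 - v k) *\<^sub>R E k \<omega>)) \<le> u\<^sup>2 / 2 * \<delta> k"
      using var[OF k] unfolding E_def norm_mult norm_of_real by (intro mult_mono) auto
    have "\<bar>1 - u\<^sup>2 / 2 * v k - exp (- (u\<^sup>2 / 2 * v k))\<bar> \<le> (u\<^sup>2 / 2 * v k)\<^sup>2 / 2"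
      by (rule exp_neg_linear_error) (use v[OF k] in simp)
    also have "\<dots> = u ^ 4 / 8 * (v k)\<^sup>2" by (simp add: power2_eq_square power4_eq_xxxx)
    finally have e3: "cmod (of_real (1 - u\<^sup>2 / 2 * v k - exp (- (u\<^sup>2 / 2) * v k)) * \<phi> k) \<le> u ^ 4 / 8 * (v k)\<^sup>2"
      using mult_mono[of _ "u ^ 4 / 8 * (v k)\<^sup>2" "cmod (\<phi> k)" 1] \<phi>_le[of k] k
      unfolding norm_mult norm_of_real by simp
    have "\<phi> (Suc k) - of_real (exp (- (u\<^sup>2 / 2) * v k)) * \<phi> k =
        of_real (1 - u\<^sup>2 / 2 * v k - exp (- (u\<^sup>2 / 2) * v k)) * \<phi> k
        - of_real (u\<^sup>2 / 2) * expectation (\<lambda>\<omega>. ((D k \<omega>)\<^sup>2 - v k) *\<^sub>R E k \<omega>) + expectation (\<lambda>\<omega>. R \<omega> * E k \<omega>)"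
      unfolding \<phi>_Suc by (simp add: algebra_simps)
    also have "cmod \<dots> \<le> u ^ 4 / 8 * (v k)\<^sup>2 + u\<^sup>2 / 2 * \<delta> k + \<bar>u\<bar> ^ 3 / 6 * \<eta> k"
      by (rule norm_triangle_le, rule add_mono, rule order_trans[OF norm_triangle_ineq4], rule add_mono) fact+
    finally show ?thesis by simp
  qed
  have "cmod (\<phi> k - of_real (exp (- (u\<^sup>2 / 2) * (\<Sum>i<k. v i))))
    \<le> (\<Sum>i<k. u\<^sup>2 / 2 * \<delta> i + \<bar>u\<bar> ^ 3 / 6 * \<eta> i + u ^ 4 / 8 * (v i)\<^sup>2)" if "k \<le> n" for k
    using that
  proof (induction k)
    case 0
    have "E 0 = (\<lambda>_. 1)" by (simp add: E_def fun_eq_iff)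
    then show ?case by (simp add: \<phi>_def prob_space)
  next
    case (Suc k)
    let ?e = "exp (- (u\<^sup>2 / 2) * v k)" and ?g = "exp (- (u\<^sup>2 / 2) * (\<Sum>i<k. v i))"
    have "0 \<le> v k" using v Suc.prems by simp
    then have e: "0 \<le> ?e" "?e \<le> 1" by auto
    have "exp (- (u\<^sup>2 / 2) * (\<Sum>i<Suc k. v i)) = ?e * ?g"
      unfolding exp_add[symmetric] by (simp add: algebra_simps)
    then have split: "\<phi> (Suc k) - of_real (exp (- (u\<^sup>2 / 2) * (\<Sum>i<Suc k. v i)))
       = (\<phi> (Suc k) - of_real ?e * \<phi> k) + of_real ?e * (\<phi> k - of_real ?g)"
      by (simp add: algebra_simps)
    have "cmod (\<phi> (Suc k) - of_real (exp (- (u\<^sup>2 / 2) * (\<Sum>i<Suc k. v i))))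
      \<le> (u\<^sup>2 / 2 * \<delta> k + \<bar>u\<bar> ^ 3 / 6 * \<eta> k + u ^ 4 / 8 * (v k)\<^sup>2) +
        (\<Sum>i<k. u\<^sup>2 / 2 * \<delta> i + \<bar>u\<bar> ^ 3 / 6 * \<eta> i + u ^ 4 / 8 * (v i)\<^sup>2)"
      unfolding split
    proof (intro norm_triangle_le add_mono)
      show "cmod (of_real ?e * (\<phi> k - of_real ?g))
          \<le> (\<Sum>i<k. u\<^sup>2 / 2 * \<delta> i + \<bar>u\<bar> ^ 3 / 6 * \<eta> i + u ^ 4 / 8 * (v i)\<^sup>2)"
        using Suc mult_left_le_one_le[OF norm_ge_zero e, of "\<phi> k - of_real ?g"]
        unfolding norm_mult norm_of_real abs_of_nonneg[OF e(1)] by linarith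
    qed (use step[of k] Suc in simp)
    then show ?case by simp
  qed
  from this[OF order_refl] show ?thesis unfolding \<phi>_def E_def[abs_def] .
qed

section \<open>Square-integrable and fourth-power integrable functions\<close>

text \<open>Polynomials of degree at most four in the scores have to be integrated at many places. Both
  classes are closed under sums, a product of two \<open>L4\<close> functions is in \<open>L2\<close>, and a product of two
  \<open>L2\<close> functions is integrable, which settles nearly all of these side conditions.\<close>

definition L2 :: "'a measure \<Rightarrow> ('a \<Rightarrow> real) \<Rightarrow> bool" where
  "L2 M f \<longleftrightarrow> f \<in> borel_measurable M \<and> integrable M (\<lambda>\<omega>. (f \<omega>)\<^sup>2)"

definition L4 :: "'a measure \<Rightarrow> ('a \<Rightarrow> real) \<Rightarrow> bool" where
  "L4 M f \<longleftrightarrow> f \<in> borel_measurable M \<and> integrable M (\<lambda>\<omega>. (f \<omega>) ^ 4)"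

lemma L2_D:
  assumes "L2 M f"
  shows "f \<in> borel_measurable M" "integrable M (\<lambda>\<omega>. (f \<omega>)\<^sup>2)"
  using assms by (auto simp: L2_def)

lemma L4_D:
  assumes "L4 M f"
  shows "f \<in> borel_measurable M" "integrable M (\<lambda>\<omega>. (f \<omega>) ^ 4)"
  using assms by (auto simp: L4_def)

lemma power2_add_le: "(x + y)\<^sup>2 \<le> 2 * x\<^sup>2 + 2 * (y::real)\<^sup>2"
  using zero_le_power2[of "x - y"] by (simp add: power2_eq_square algebra_simps)

lemma power4_add_le: "(x + y) ^ 4 \<le> 8 * x ^ 4 + 8 * (y::real) ^ 4"
proof -
  have "(x + y) ^ 4 = ((x + y)\<^sup>2)\<^sup>2" by simp
  also have "\<dots> \<le> (2 * x\<^sup>2 + 2 * y\<^sup>2)\<^sup>2"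
    by (rule power_mono[OF power2_add_le]) simp
  also have "\<dots> \<le> 2 * (2 * x\<^sup>2)\<^sup>2 + 2 * (2 * y\<^sup>2)\<^sup>2" by (rule power2_add_le)
  finally show ?thesis by (simp add: power_mult_distrib)
qed

lemma L2_add:
  assumes "L2 M f" "L2 M g"
  shows "L2 M (\<lambda>\<omega>. f \<omega> + g \<omega>)"
proof -
  note [measurable] = L2_D(1)[OF assms(1)] L2_D(1)[OF assms(2)]
  have "integrable M (\<lambda>\<omega>. (f \<omega> + g \<omega>)\<^sup>2)"
    by (rule Bochner_Integration.integrable_bound[of _ "\<lambda>\<omega>. 2 * (f \<omega>)\<^sup>2 + 2 * (g \<omega>)\<^sup>2"])
      (use L2_D(2)[OF assms(1)] L2_D(2)[OF assms(2)] in \<open>auto intro!: AE_I2 power2_add_le\<close>)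
  then show ?thesis by (simp add: L2_def)
qed

lemma L4_add:
  assumes "L4 M f" "L4 M g"
  shows "L4 M (\<lambda>\<omega>. f \<omega> + g \<omega>)"
proof -
  note [measurable] = L4_D(1)[OF assms(1)] L4_D(1)[OF assms(2)]
  have "integrable M (\<lambda>\<omega>. (f \<omega> + g \<omega>) ^ 4)"
    by (rule Bochner_Integration.integrable_bound[of _ "\<lambda>\<omega>. 8 * (f \<omega>) ^ 4 + 8 * (g \<omega>) ^ 4"])
      (use L4_D(2)[OF assms(1)] L4_D(2)[OF assms(2)] in \<open>auto intro!: AE_I2 power4_add_le\<close>)
  then show ?thesis by (simp add: L4_def)
qed

lemma L2_cmult: "L2 M f \<Longrightarrow> L2 M (\<lambda>\<omega>. c * f \<omega>)"
  by (auto simp: L2_def power_mult_distrib)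

lemma L4_cmult: "L4 M f \<Longrightarrow> L4 M (\<lambda>\<omega>. c * f \<omega>)"
  by (auto simp: L4_def power_mult_distrib)

lemma L2_diff: "L2 M f \<Longrightarrow> L2 M g \<Longrightarrow> L2 M (\<lambda>\<omega>. f \<omega> - g \<omega>)"
  using L2_add[of M f "\<lambda>\<omega>. (-1) * g \<omega>"] L2_cmult[of M g "-1"] by simp

lemma (in prob_space) L2_const: "L2 M (\<lambda>\<omega>. c)"
  by (simp add: L2_def)

lemma (in prob_space) L4_const: "L4 M (\<lambda>\<omega>. c)"
  by (simp add: L4_def)

lemma (in prob_space) L2_sum: "finite I \<Longrightarrow> (\<And>i. i \<in> I \<Longrightarrow> L2 M (f i)) \<Longrightarrow> L2 M (\<lambda>\<omega>. \<Sum>i\<in>I. f i \<omega>)"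
  by (induction I rule: finite_induct) (auto intro: L2_const L2_add)

lemma (in prob_space) L4_sum: "finite I \<Longrightarrow> (\<And>i. i \<in> I \<Longrightarrow> L4 M (f i)) \<Longrightarrow> L4 M (\<lambda>\<omega>. \<Sum>i\<in>I. f i \<omega>)"
  by (induction I rule: finite_induct) (auto intro: L4_const L4_add)

lemma abs_mult_le_squares: "\<bar>x * y\<bar> \<le> x\<^sup>2 + (y::real)\<^sup>2"
proof -
  have "2 * \<bar>x * y\<bar> \<le> x\<^sup>2 + y\<^sup>2"
    using zero_le_power2[of "\<bar>x\<bar> - \<bar>y\<bar>"] by (simp add: power2_diff abs_mult)
  then show ?thesis by linarith
qed

lemma L2_mult_integrable:
  assumes "L2 M f" "L2 M g"
  shows "integrable M (\<lambda>\<omega>. f \<omega> * g \<omega>)"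
proof -
  note [measurable] = L2_D(1)[OF assms(1)] L2_D(1)[OF assms(2)]
  show ?thesis
    by (rule Bochner_Integration.integrable_bound[of _ "\<lambda>\<omega>. (f \<omega>)\<^sup>2 + (g \<omega>)\<^sup>2"])
      (use L2_D(2)[OF assms(1)] L2_D(2)[OF assms(2)] in \<open>auto intro!: AE_I2 simp: abs_mult_le_squares\<close>)
qed

lemma (in prob_space) L2_integrable: "L2 M f \<Longrightarrow> integrable M f"
  using L2_mult_integrable[of M f "\<lambda>_. 1"] L2_const[of 1] by simp

lemma L4_mult:
  assumes "L4 M f" "L4 M g"
  shows "L2 M (\<lambda>\<omega>. f \<omega> * g \<omega>)"
proof -
  note [measurable] = L4_D(1)[OF assms(1)] L4_D(1)[OF assms(2)]
  have "integrable M (\<lambda>\<omega>. (f \<omega>)\<^sup>2 * (g \<omega>)\<^sup>2)"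
    by (rule L2_mult_integrable) (use L4_D(2)[OF assms(1)] L4_D(2)[OF assms(2)] in \<open>auto simp: L2_def\<close>)
  then show ?thesis by (simp add: L2_def power_mult_distrib)
qed

lemma (in prob_space) L4_imp_L2: "L4 M f \<Longrightarrow> L2 M f"
  using L4_mult[of M f "\<lambda>_. 1"] L4_const[of 1] by simp

lemma (in prob_space) expectation_abs_le_sqrt:
  assumes "L2 M f" "expectation (\<lambda>\<omega>. (f \<omega>)\<^sup>2) \<le> c"
  shows "expectation (\<lambda>\<omega>. \<bar>f \<omega>\<bar>) \<le> sqrt c"
proof -
  have i: "integrable M (\<lambda>\<omega>. \<bar>f \<omega>\<bar>)" using L2_integrable[OF assms(1)] by simp
  have "0 \<le> variance (\<lambda>\<omega>. \<bar>f \<omega>\<bar>)" by simp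
  also have "variance (\<lambda>\<omega>. \<bar>f \<omega>\<bar>) = expectation (\<lambda>\<omega>. (f \<omega>)\<^sup>2) - (expectation (\<lambda>\<omega>. \<bar>f \<omega>\<bar>))\<^sup>2"
    using variance_eq[OF i] L2_D(2)[OF assms(1)] by simp
  finally have "(expectation (\<lambda>\<omega>. \<bar>f \<omega>\<bar>))\<^sup>2 \<le> c" using assms(2) by simp
  then show ?thesis by (rule real_le_rsqrt)
qed

section \<open>The inner product of the first coordinates\<close>

text \<open>Vectors are functions of which only the first \<open>p\<close> values matter, as in \<^term>\<open>vec_space p\<close>.\<close>

definition dot :: "nat \<Rightarrow> (nat \<Rightarrow> real) \<Rightarrow> (nat \<Rightarrow> real) \<Rightarrow> real" where
  "dot p x y = (\<Sum>j<p. x j * y j)"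

lemma dot_commute: "dot p x y = dot p y x"
  by (simp add: dot_def mult.commute)

lemma dot_add_left: "dot p (\<lambda>j. x j + y j) z = dot p x z + dot p y z"
  by (simp add: dot_def distrib_right sum.distrib)

lemma dot_scale_left: "dot p (\<lambda>j. c * x j) z = c * dot p x z"
  by (simp add: dot_def sum_distrib_left mult.assoc)

lemma dot_add_right: "dot p z (\<lambda>j. x j + y j) = dot p z x + dot p z y"
  by (simp add: dot_def distrib_left sum.distrib)

lemma dot_scale_right: "dot p z (\<lambda>j. c * x j) = c * dot p z x"
  by (simp add: dot_def sum_distrib_left algebra_simps)

lemma dot_self_nonneg: "0 \<le> dot p x x"
  by (simp add: dot_def sum_nonneg)

lemma dot_Cauchy_Schwarz: "(dot p x y)\<^sup>2 \<le> dot p x x * dot p y y"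
  using Cauchy_Schwarz_ineq_sum[of x y "{..<p}"] by (simp add: dot_def power2_eq_square)

text \<open>Coordinates are linear functionals, so that coordinatewise moments are instances of moments of
  \<^const>\<open>dot\<close>.\<close>

lemma dot_unit: "j < p \<Longrightarrow> dot p (\<lambda>k. if k = j then 1 else 0) x = x j"
  by (simp add: dot_def if_distrib[of "\<lambda>z. z * _"] cong: if_cong)

lemma borel_measurable_dot[measurable (raw)]:
  assumes "\<And>j. j < p \<Longrightarrow> (\<lambda>x. f x j) \<in> borel_measurable N"
    and "\<And>j. j < p \<Longrightarrow> (\<lambda>x. g x j) \<in> borel_measurable N"
  shows "(\<lambda>x. dot p (f x) (g x)) \<in> borel_measurable N"
  unfolding dot_def by (intro borel_measurable_sum borel_measurable_times) (use assms in auto)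

lemma (in prob_space) L4_dot:
  assumes "\<And>j. j < p \<Longrightarrow> L4 M (\<lambda>\<omega>. f \<omega> j)" "\<And>j. j < p \<Longrightarrow> L4 M (\<lambda>\<omega>. g \<omega> j)"
  shows "L2 M (\<lambda>\<omega>. dot p (f \<omega>) (g \<omega>))"
  unfolding dot_def by (intro L2_sum L4_mult assms) auto

lemma (in prob_space) L4_dot_const:
  assumes "\<And>j. j < p \<Longrightarrow> L4 M (\<lambda>\<omega>. f \<omega> j)"
  shows "L4 M (\<lambda>\<omega>. dot p x (f \<omega>))"
  unfolding dot_def by (intro L4_sum L4_cmult assms) auto

section \<open>Independent vectors, conditionally on the past\<close>

text \<open>All that the limit theorem needs to know about the scores \<open>w i\<close>, with \<open>s\<close> in the role of
  \<open>\<sigma>\<^sup>2 + \<beta>\<^sup>T \<beta>\<close>: the covariance matrix is \<open>s I + \<beta> \<beta>\<^sup>T\<close> and fourth moments are comparable with squared second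
  moments in every direction. Moments are prescribed for linear functionals and not for the
  coordinates because then the past can be substituted for the vector \<open>x\<close>.\<close>

locale score_sample = prob_space M
  for M :: "'a measure" +
  fixes n p :: nat
    and w :: "nat \<Rightarrow> 'a \<Rightarrow> nat \<Rightarrow> real"
    and \<beta> :: "nat \<Rightarrow> real"
    and s K :: real
  assumes w_indep: "indep_vars (\<lambda>_. vec_space p) w {..<n}"
    and w_L4: "\<And>i j. i < n \<Longrightarrow> j < p \<Longrightarrow> L4 M (\<lambda>\<omega>. w i \<omega> j)"
    and w_mean: "\<And>i x. i < n \<Longrightarrow> expectation (\<lambda>\<omega>. dot p x (w i \<omega>)) = 0"
    and w_second: "\<And>i x. i < n \<Longrightarrow>
      expectation (\<lambda>\<omega>. (dot p x (w i \<omega>))\<^sup>2) = s * dot p x x + (dot p x \<beta>)\<^sup>2"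
    and w_fourth: "\<And>i x. i < n \<Longrightarrow>
      expectation (\<lambda>\<omega>. (dot p x (w i \<omega>)) ^ 4) \<le> K * s\<^sup>2 * (dot p x x)\<^sup>2"
    and s_pos: "0 < s"
    and signal_le: "dot p \<beta> \<beta> \<le> s"
    and K_ge: "1 \<le> K"
    and p_ge: "1 \<le> p"
begin

abbreviation past_space :: "nat \<Rightarrow> (nat \<Rightarrow> nat \<Rightarrow> real) measure" where
  "past_space b \<equiv> PiM {..<b} (\<lambda>_. vec_space p)"

text \<open>The past is restricted to its indices, so that it is an element of the product space and its
  independence of \<open>w b\<close> is an instance of grouping independent variables.\<close>

definition past :: "nat \<Rightarrow> 'a \<Rightarrow> nat \<Rightarrow> nat \<Rightarrow> real" where
  "past b \<omega> = restrict (\<lambda>a. w a \<omega>) {..<b}"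

lemma w_measurable[measurable]: "i < n \<Longrightarrow> w i \<in> measurable M (vec_space p)"
  using w_indep by (auto simp: indep_vars_def)

lemma past_measurable[measurable]: "b \<le> n \<Longrightarrow> past b \<in> measurable M (past_space b)"
  unfolding past_def by (intro measurable_restrict w_measurable) auto

lemma past_indep:
  assumes "b < n"
  shows "indep_var (past_space b) (past b) (PiM {b} (\<lambda>_. vec_space p)) (\<lambda>\<omega>. restrict (\<lambda>a. w a \<omega>) {b})"
  unfolding past_def[abs_def] by (rule indep_var_restrict[OF w_indep]) (use assms in auto)

text \<open>Two variables that are declared independent share one type. The present is therefore viewed, like the
  past, as a family of vectors, with the single index \<open>b\<close>, and \<open>f\<close> is applied to its only member.\<close>

lemma conditioning_on_past:
  fixes f :: "(nat \<Rightarrow> nat \<Rightarrow> real) \<times> (nat \<Rightarrow> real) \<Rightarrow> 'c::{banach, second_countable_topology}"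
  assumes "b < n" and [measurable]: "f \<in> borel_measurable (past_space b \<Otimes>\<^sub>M vec_space p)"
    and "integrable M (\<lambda>\<omega>. f (past b \<omega>, w b \<omega>))"
  shows "(\<integral>\<omega>. f (past b \<omega>, w b \<omega>) \<partial>M) = (\<integral>\<omega>. (\<integral>\<omega>'. f (past b \<omega>, w b \<omega>') \<partial>M) \<partial>M)"
  using indep_var_integral_iterated[OF past_indep[OF assms(1)], of "\<lambda>(h, z). f (h, z b)"] assms(3)
  by simp

lemma nn_conditioning_on_past:
  assumes "b < n" and [measurable]: "f \<in> borel_measurable (past_space b \<Otimes>\<^sub>M vec_space p)"
  shows "(\<integral>\<^sup>+\<omega>. f (past b \<omega>, w b \<omega>) \<partial>M) = (\<integral>\<^sup>+\<omega>. (\<integral>\<^sup>+\<omega>'. f (past b \<omega>, w b \<omega>') \<partial>M) \<partial>M)"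
  using indep_var_nn_integral_iterated[OF past_indep[OF assms(1)], of "\<lambda>(h, z). f (h, z b)"]
  by simp

lemma w_dot_L4: "i < n \<Longrightarrow> L4 M (\<lambda>\<omega>. dot p x (w i \<omega>))"
  by (intro L4_dot_const w_L4)

lemma w_dot_integrable: "i < n \<Longrightarrow> integrable M (\<lambda>\<omega>. dot p x (w i \<omega>))"
  by (intro L2_integrable L4_imp_L2 w_dot_L4)

text \<open>The next three lemmas substitute a function \<open>a\<close> of the past for the vector in the moments of
  linear functionals. A further factor \<open>g\<close>, real or complex, that depends on the past may be present; for the first two
  this expresses the conditional mean and the conditional variance.\<close>

lemma past_linear:
  fixes g :: "(nat \<Rightarrow> nat \<Rightarrow> real) \<Rightarrow> 'c::{banach, second_countable_topology}"
  assumes "b < n" and [measurable]: "g \<in> borel_measurable (past_space b)"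
    and [measurable]: "\<And>j. j < p \<Longrightarrow> (\<lambda>h. a h j) \<in> borel_measurable (past_space b)"
    and int: "integrable M (\<lambda>\<omega>. dot p (a (past b \<omega>)) (w b \<omega>) *\<^sub>R g (past b \<omega>))"
  shows "(\<integral>\<omega>. dot p (a (past b \<omega>)) (w b \<omega>) *\<^sub>R g (past b \<omega>) \<partial>M) = 0"
proof -
  have "(\<integral>\<omega>. dot p (a (past b \<omega>)) (w b \<omega>) *\<^sub>R g (past b \<omega>) \<partial>M)
      = (\<integral>\<omega>. (\<integral>\<omega>'. dot p (a (past b \<omega>)) (w b \<omega>') *\<^sub>R g (past b \<omega>) \<partial>M) \<partial>M)"
    using conditioning_on_past[OF assms(1), of "\<lambda>(h, z). dot p (a h) z *\<^sub>R g h"] int by simp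
  also have "\<dots> = (\<integral>\<omega>. 0 \<partial>M)"
    by (intro Bochner_Integration.integral_cong refl)
      (simp add: w_dot_integrable[OF assms(1)] w_mean[OF assms(1)])
  finally show ?thesis by simp
qed

lemma past_square:
  fixes g :: "(nat \<Rightarrow> nat \<Rightarrow> real) \<Rightarrow> 'c::{banach, second_countable_topology}"
  assumes "b < n" and [measurable]: "g \<in> borel_measurable (past_space b)"
    and [measurable]: "\<And>j. j < p \<Longrightarrow> (\<lambda>h. a h j) \<in> borel_measurable (past_space b)"
    and int: "integrable M (\<lambda>\<omega>. (dot p (a (past b \<omega>)) (w b \<omega>))\<^sup>2 *\<^sub>R g (past b \<omega>))"
  shows "(\<integral>\<omega>. (dot p (a (past b \<omega>)) (w b \<omega>))\<^sup>2 *\<^sub>R g (past b \<omega>) \<partial>M) =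
    (\<integral>\<omega>. (s * dot p (a (past b \<omega>)) (a (past b \<omega>)) + (dot p (a (past b \<omega>)) \<beta>)\<^sup>2) *\<^sub>R g (past b \<omega>) \<partial>M)"
proof -
  have "(\<integral>\<omega>. (dot p (a (past b \<omega>)) (w b \<omega>))\<^sup>2 *\<^sub>R g (past b \<omega>) \<partial>M)
      = (\<integral>\<omega>. (\<integral>\<omega>'. (dot p (a (past b \<omega>)) (w b \<omega>'))\<^sup>2 *\<^sub>R g (past b \<omega>) \<partial>M) \<partial>M)"
    using conditioning_on_past[OF assms(1), of "\<lambda>(h, z). (dot p (a h) z)\<^sup>2 *\<^sub>R g h"] int by simp
  also have "\<dots> = (\<integral>\<omega>. (s * dot p (a (past b \<omega>)) (a (past b \<omega>)) + (dot p (a (past b \<omega>)) \<beta>)\<^sup>2) *\<^sub>R g (past b \<omega>) \<partial>M)"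
    by (intro Bochner_Integration.integral_cong refl)
      (simp add: L2_D(2)[OF L4_imp_L2[OF w_dot_L4[OF assms(1)]]] w_second[OF assms(1)])
  finally show ?thesis .
qed

text \<open>Integrability is part of the conclusion: the integral is first evaluated
  in the extended nonnegative reals, where the iterated integral needs no integrability.\<close>

lemma past_fourth:
  assumes b: "b < n"
    and [measurable]: "\<And>j. j < p \<Longrightarrow> (\<lambda>h. a h j) \<in> borel_measurable (past_space b)"
    and int: "L2 M (\<lambda>\<omega>. dot p (a (past b \<omega>)) (a (past b \<omega>)))"
  shows "L4 M (\<lambda>\<omega>. dot p (a (past b \<omega>)) (w b \<omega>))"
    and "expectation (\<lambda>\<omega>. (dot p (a (past b \<omega>)) (w b \<omega>)) ^ 4)
      \<le> K * s\<^sup>2 * expectation (\<lambda>\<omega>. (dot p (a (past b \<omega>)) (a (past b \<omega>)))\<^sup>2)"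
proof -
  have [measurable]: "past b \<in> measurable M (past_space b)" "w b \<in> measurable M (vec_space p)" using b by auto
  have m[measurable]: "(\<lambda>\<omega>. dot p (a (past b \<omega>)) (w b \<omega>)) \<in> borel_measurable M"
    using measurable_compose[OF measurable_Pair[of "past b" M "past_space b" "w b" "vec_space p"], of "\<lambda>(h, z). dot p (a h) z"]
    by simp
  have Ks: "0 \<le> K * s\<^sup>2" using K_ge by simp
  have "(\<integral>\<^sup>+\<omega>. ennreal ((dot p (a (past b \<omega>)) (w b \<omega>)) ^ 4) \<partial>M)
      = (\<integral>\<^sup>+\<omega>. (\<integral>\<^sup>+\<omega>'. ennreal ((dot p (a (past b \<omega>)) (w b \<omega>')) ^ 4) \<partial>M) \<partial>M)"
    using nn_conditioning_on_past[OF b, of "\<lambda>(h, z). ennreal ((dot p (a h) z) ^ 4)"] by simp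
  also have "\<dots> = (\<integral>\<^sup>+\<omega>. ennreal (\<integral>\<omega>'. (dot p (a (past b \<omega>)) (w b \<omega>')) ^ 4 \<partial>M) \<partial>M)"
    by (intro nn_integral_cong nn_integral_eq_integral L4_D(2) w_dot_L4 b) auto
  also have "\<dots> \<le> (\<integral>\<^sup>+\<omega>. ennreal (K * s\<^sup>2 * (dot p (a (past b \<omega>)) (a (past b \<omega>)))\<^sup>2) \<partial>M)"
    by (intro nn_integral_mono ennreal_leI w_fourth b)
  also have "\<dots> = ennreal (\<integral>\<omega>. K * s\<^sup>2 * (dot p (a (past b \<omega>)) (a (past b \<omega>)))\<^sup>2 \<partial>M)"
    by (intro nn_integral_eq_integral integrable_mult_right L2_D(2)[OF int]) (use Ks in auto)
  finally have le: "(\<integral>\<^sup>+\<omega>. ennreal ((dot p (a (past b \<omega>)) (w b \<omega>)) ^ 4) \<partial>M)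
    \<le> ennreal (K * s\<^sup>2 * (\<integral>\<omega>. (dot p (a (past b \<omega>)) (a (past b \<omega>)))\<^sup>2 \<partial>M))" by simp
  have i: "integrable M (\<lambda>\<omega>. (dot p (a (past b \<omega>)) (w b \<omega>)) ^ 4)"
    by (rule integrableI_bounded) (use le in \<open>auto simp: le_less_trans\<close>)
  then show "L4 M (\<lambda>\<omega>. dot p (a (past b \<omega>)) (w b \<omega>))" by (simp add: L4_def)
  show "expectation (\<lambda>\<omega>. (dot p (a (past b \<omega>)) (w b \<omega>)) ^ 4)
      \<le> K * s\<^sup>2 * expectation (\<lambda>\<omega>. (dot p (a (past b \<omega>)) (a (past b \<omega>)))\<^sup>2)"
    using le Ks by (subst (asm) nn_integral_eq_integral[OF i]) (auto simp: ennreal_le_iff)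
qed

abbreviation t :: real where "t \<equiv> dot p \<beta> \<beta>"

text \<open>The mean of \<open>w\<^sub>i\<^sup>T w\<^sub>i\<close>, that is, the trace of the covariance matrix.\<close>

definition \<mu> :: real where "\<mu> = s * real p + t"

lemma t_nonneg: "0 \<le> t" by (rule dot_self_nonneg)

lemma st_le: "s * t + t\<^sup>2 \<le> 2 * s * t"
  using mult_right_mono[OF signal_le t_nonneg] by (simp add: power2_eq_square)

lemma \<mu>_le: "\<mu> \<le> 2 * s * real p" and \<mu>_nonneg: "0 \<le> \<mu>"
proof -
  have "s * 1 \<le> s * real p" using s_pos p_ge by (intro mult_left_mono) auto
  with signal_le t_nonneg s_pos show "\<mu> \<le> 2 * s * real p" "0 \<le> \<mu>"
    unfolding \<mu>_def by linarith+
qed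

lemma w_coord_second: "i < n \<Longrightarrow> j < p \<Longrightarrow> expectation (\<lambda>\<omega>. (w i \<omega> j)\<^sup>2) = s + (\<beta> j)\<^sup>2"
  using w_second[of i "\<lambda>k. if k = j then 1 else 0"] by (simp add: dot_unit)

lemma w_coord_fourth: "i < n \<Longrightarrow> j < p \<Longrightarrow> expectation (\<lambda>\<omega>. (w i \<omega> j) ^ 4) \<le> K * s\<^sup>2"
  using w_fourth[of i "\<lambda>k. if k = j then 1 else 0"] by (simp add: dot_unit)

lemma w_norm_L2: "i < n \<Longrightarrow> L2 M (\<lambda>\<omega>. dot p (w i \<omega>) (w i \<omega>))"
  by (intro L4_dot w_L4)

lemma w_norm_mean:
  assumes "i < n"
  shows "expectation (\<lambda>\<omega>. dot p (w i \<omega>) (w i \<omega>)) = \<mu>"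
proof -
  have "expectation (\<lambda>\<omega>. dot p (w i \<omega>) (w i \<omega>)) = (\<Sum>j<p. expectation (\<lambda>\<omega>. (w i \<omega> j)\<^sup>2))"
    unfolding dot_def power2_eq_square[symmetric]
    by (intro Bochner_Integration.integral_sum L2_D(2) L4_imp_L2 w_L4) (use assms in auto)
  also have "\<dots> = (\<Sum>j<p. s + (\<beta> j)\<^sup>2)" using assms by (intro sum.cong refl w_coord_second) auto
  also have "\<dots> = \<mu>" by (simp add: \<mu>_def dot_def sum.distrib power2_eq_square)
  finally show ?thesis .
qed

text \<open>By the Cauchy-Schwarz inequality over the \<open>p\<close> coordinates the fourth moment of the length is at
  most \<open>p\<^sup>2\<close> times the fourth moment of a coordinate. This crude bound suffices, as it is needed only
  for the diagonal terms of \<open>S\<^sup>T S\<close>, of which there are \<open>b\<close> instead of \<open>b\<^sup>2\<close>.\<close>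

lemma w_norm_variance:
  assumes i: "i < n"
  shows "expectation (\<lambda>\<omega>. (dot p (w i \<omega>) (w i \<omega>) - \<mu>)\<^sup>2) \<le> K * s\<^sup>2 * (real p)\<^sup>2"
proof -
  note L2 = w_norm_L2[OF i]
  have "expectation (\<lambda>\<omega>. (dot p (w i \<omega>) (w i \<omega>) - \<mu>)\<^sup>2) = variance (\<lambda>\<omega>. dot p (w i \<omega>) (w i \<omega>))"
    by (simp add: w_norm_mean[OF i])
  also have "\<dots> \<le> expectation (\<lambda>\<omega>. (dot p (w i \<omega>) (w i \<omega>))\<^sup>2)"
    by (subst variance_eq[OF L2_integrable[OF L2] L2_D(2)[OF L2]]) simp
  also have "\<dots> \<le> expectation (\<lambda>\<omega>. real p * (\<Sum>j<p. (w i \<omega> j) ^ 4))"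
  proof (rule integral_mono[OF L2_D(2)[OF L2]])
    show "integrable M (\<lambda>\<omega>. real p * (\<Sum>j<p. (w i \<omega> j) ^ 4))"
      by (intro integrable_mult_right Bochner_Integration.integrable_sum L4_D(2) w_L4) (use i in auto)
    fix \<omega>
    have "(\<Sum>j<p. 1 * (w i \<omega> j)\<^sup>2)\<^sup>2 \<le> (\<Sum>j<p. 1\<^sup>2) * (\<Sum>j<p. ((w i \<omega> j)\<^sup>2)\<^sup>2)"
      by (rule Cauchy_Schwarz_ineq_sum)
    then show "(dot p (w i \<omega>) (w i \<omega>))\<^sup>2 \<le> real p * (\<Sum>j<p. (w i \<omega> j) ^ 4)"
      by (simp add: dot_def power2_eq_square[symmetric])
  qed
  also have "\<dots> = real p * (\<Sum>j<p. expectation (\<lambda>\<omega>. (w i \<omega> j) ^ 4))"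
    by (subst integral_mult_right_zero, subst Bochner_Integration.integral_sum) (use i in \<open>auto intro: L4_D(2) w_L4\<close>)
  also have "\<dots> \<le> real p * (\<Sum>j<p. K * s\<^sup>2)"
    by (intro mult_left_mono sum_mono w_coord_fourth) (use i in auto)
  finally show ?thesis by (simp add: power2_eq_square algebra_simps)
qed

section \<open>Length and direction of the random walk\<close>

definition psum :: "nat \<Rightarrow> (nat \<Rightarrow> nat \<Rightarrow> real) \<Rightarrow> nat \<Rightarrow> real" where
  "psum b h j = (\<Sum>a<b. h a j)"

text \<open>The random walk of the scores, expressed through the past so that the conditioning lemmas apply
  to it.\<close>

abbreviation S :: "nat \<Rightarrow> 'a \<Rightarrow> nat \<Rightarrow> real" where
  "S b \<omega> \<equiv> psum b (past b \<omega>)"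

lemma psum_past: "a \<le> b \<Longrightarrow> psum a (past b \<omega>) j = (\<Sum>i<a. w i \<omega> j)"
  unfolding psum_def past_def by (intro sum.cong) auto

lemma S_0: "S 0 \<omega> = (\<lambda>j. 0)"
  by (simp add: psum_def fun_eq_iff)

lemma S_Suc: "S (Suc b) \<omega> = (\<lambda>j. S b \<omega> j + w b \<omega> j)"
  by (simp add: fun_eq_iff psum_past)

lemma past_coord_measurable[measurable]:
  assumes "a < b" "j < p"
  shows "(\<lambda>h. h a j) \<in> borel_measurable (past_space b)"
proof -
  have "(\<lambda>h. h a) \<in> measurable (past_space b) (vec_space p)"
    by (rule measurable_component_singleton) (use assms in auto)
  moreover have "(\<lambda>x. x j) \<in> borel_measurable (vec_space p)"
    by (rule measurable_component_singleton) (use assms in auto)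
  ultimately show ?thesis by (rule measurable_compose)
qed

lemma psum_measurable[measurable]: "a \<le> b \<Longrightarrow> j < p \<Longrightarrow> (\<lambda>h. psum a h j) \<in> borel_measurable (past_space b)"
  unfolding psum_def by (intro borel_measurable_sum past_coord_measurable) auto

lemma S_L4: "b \<le> n \<Longrightarrow> j < p \<Longrightarrow> L4 M (\<lambda>\<omega>. S b \<omega> j)"
  unfolding psum_past[OF order_refl] by (intro L4_sum w_L4) auto

lemma S_dot_L4: "b \<le> n \<Longrightarrow> L4 M (\<lambda>\<omega>. dot p x (S b \<omega>))"
  by (intro L4_dot_const S_L4)

lemma S_norm_L2: "b \<le> n \<Longrightarrow> L2 M (\<lambda>\<omega>. dot p (S b \<omega>) (S b \<omega>))"
  by (intro L4_dot S_L4)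

text \<open>Independent centred steps: the cross terms vanish and each step adds \<open>E (\<beta>\<^sup>T w\<^sub>b)\<^sup>2 = s t + t\<^sup>2\<close>.\<close>

lemma dot_S_second:
  "b \<le> n \<Longrightarrow> expectation (\<lambda>\<omega>. (dot p \<beta> (S b \<omega>))\<^sup>2) = real b * (s * t + t\<^sup>2)"
proof (induction b)
  case 0
  show ?case by (simp add: S_0 dot_def)
next
  case (Suc b)
  then have b: "b < n" by simp
  have L: "L4 M (\<lambda>\<omega>. dot p \<beta> (S b \<omega>))" "L4 M (\<lambda>\<omega>. dot p \<beta> (w b \<omega>))"
    using b by (auto intro: S_dot_L4 w_dot_L4)
  have cross_int: "integrable M (\<lambda>\<omega>. dot p \<beta> (w b \<omega>) * dot p \<beta> (S b \<omega>))"
    by (intro L2_mult_integrable L4_imp_L2 L)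
  have cross: "expectation (\<lambda>\<omega>. dot p \<beta> (w b \<omega>) * dot p \<beta> (S b \<omega>)) = 0"
    using past_linear[OF b, of "\<lambda>h. dot p \<beta> (psum b h)" "\<lambda>_. \<beta>"] cross_int by simp
  have "expectation (\<lambda>\<omega>. (dot p \<beta> (S (Suc b) \<omega>))\<^sup>2) = expectation (\<lambda>\<omega>.
      (dot p \<beta> (S b \<omega>))\<^sup>2 + 2 * (dot p \<beta> (w b \<omega>) * dot p \<beta> (S b \<omega>)) + (dot p \<beta> (w b \<omega>))\<^sup>2)"
    by (intro Bochner_Integration.integral_cong refl) (simp add: S_Suc dot_add_right power2_eq_square algebra_simps)
  also have "\<dots> = expectation (\<lambda>\<omega>. (dot p \<beta> (S b \<omega>))\<^sup>2) + expectation (\<lambda>\<omega>. (dot p \<beta> (w b \<omega>))\<^sup>2)"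
    using L2_D(2)[OF L4_imp_L2[OF L(1)]] L2_D(2)[OF L4_imp_L2[OF L(2)]] cross_int by (simp add: cross)
  also have "\<dots> = real (Suc b) * (s * t + t\<^sup>2)"
    using Suc b by (simp add: w_second algebra_simps)
  finally show ?case .
qed

lemma w_S_L4: "b < n \<Longrightarrow> L4 M (\<lambda>\<omega>. dot p (S b \<omega>) (w b \<omega>))"
  by (rule past_fourth(1)[of b "psum b"]) (auto intro: S_norm_L2)

lemma S_norm_mean: "b \<le> n \<Longrightarrow> expectation (\<lambda>\<omega>. dot p (S b \<omega>) (S b \<omega>)) = real b * \<mu>"
proof (induction b)
  case 0
  show ?case by (simp add: S_0 dot_def)
next
  case (Suc b)
  then have b: "b < n" by simp
  have cross_int: "integrable M (\<lambda>\<omega>. dot p (S b \<omega>) (w b \<omega>))"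
    by (intro L2_integrable L4_imp_L2 w_S_L4 b)
  have cross: "expectation (\<lambda>\<omega>. dot p (S b \<omega>) (w b \<omega>)) = 0"
    using past_linear[OF b, of "\<lambda>_. 1::real" "psum b"] cross_int by simp
  have "expectation (\<lambda>\<omega>. dot p (S (Suc b) \<omega>) (S (Suc b) \<omega>)) = expectation (\<lambda>\<omega>.
      dot p (S b \<omega>) (S b \<omega>) + 2 * dot p (S b \<omega>) (w b \<omega>) + dot p (w b \<omega>) (w b \<omega>))"
    by (intro Bochner_Integration.integral_cong refl)
      (simp add: S_Suc dot_add_right dot_add_left dot_commute[of p "w b _" "S b _"])
  also have "\<dots> = real b * \<mu> + \<mu>"
    using L2_integrable[OF S_norm_L2[of b]] L2_integrable[OF w_norm_L2[OF b]] cross_int Suc b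
    by (simp add: cross w_norm_mean)
  finally show ?case by (simp add: algebra_simps)
qed

lemma w_S_second:
  assumes b: "b < n"
  shows "expectation (\<lambda>\<omega>. (dot p (S b \<omega>) (w b \<omega>))\<^sup>2) = real b * (s * \<mu> + (s * t + t\<^sup>2))"
proof -
  have "expectation (\<lambda>\<omega>. (dot p (S b \<omega>) (w b \<omega>))\<^sup>2)
     = expectation (\<lambda>\<omega>. s * dot p (S b \<omega>) (S b \<omega>) + (dot p (S b \<omega>) \<beta>)\<^sup>2)"
    using past_square[OF b, of "\<lambda>_. 1::real" "psum b"] L2_D(2)[OF L4_imp_L2[OF w_S_L4[OF b]]] by simp
  also have "\<dots> = s * (real b * \<mu>) + real b * (s * t + t\<^sup>2)"
    using L2_integrable[OF S_norm_L2[of b]] L2_D(2)[OF L4_imp_L2[OF S_dot_L4[of b \<beta>]]] b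
      S_norm_mean[of b] dot_S_second[of b] by (simp add: dot_commute[of p "S b _" \<beta>])
  finally show ?thesis by (simp add: algebra_simps)
qed

text \<open>The concentration of the squared length of the walk, which is what makes conditional variances nearly
  deterministic. The process \<open>S\<^sub>b\<^sup>T S\<^sub>b - b \<mu>\<close> is a martingale with increments
  \<open>2 S\<^sub>b\<^sup>T w\<^sub>b + (w\<^sub>b\<^sup>T w\<^sub>b - \<mu>)\<close>, so its variance is the sum of the second moments of the increments. Those
  of the first summand are of order \<open>s\<^sup>2 p n\<close> and those of the second of order \<open>s\<^sup>2 p\<^sup>2\<close>. The standard deviation
  is hence of order \<open>s n \<surd>p + s p \<surd>n\<close>, compared with \<open>s p n\<close> for the squared length itself.\<close>

lemma S_norm_variance:
  assumes "b \<le> n"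
  shows "expectation (\<lambda>\<omega>. (dot p (S b \<omega>) (S b \<omega>) - real b * \<mu>)\<^sup>2)
    \<le> real b * (32 * s\<^sup>2 * real p * real n + 2 * K * s\<^sup>2 * (real p)\<^sup>2)"
  using assms
proof (induction b)
  case 0
  show ?case by (simp add: S_0 dot_def)
next
  case (Suc b)
  then have b: "b < n" by simp
  define r where "r \<omega> = dot p (S b \<omega>) (S b \<omega>) - real b * \<mu>" for \<omega>
  define x where "x \<omega> = dot p (S b \<omega>) (w b \<omega>)" for \<omega>
  define y where "y \<omega> = dot p (w b \<omega>) (w b \<omega>) - \<mu>" for \<omega>
  have r: "L2 M r" unfolding r_def using b by (intro L2_diff L2_const S_norm_L2) auto
  have x: "L2 M x" unfolding x_def by (intro L4_imp_L2 w_S_L4 b)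
  have y: "L2 M y" unfolding y_def by (intro L2_diff L2_const w_norm_L2 b)
  have xy: "L2 M (\<lambda>\<omega>. 2 * x \<omega> + y \<omega>)" by (intro L2_add L2_cmult x y)
  \<comment> \<open>Both parts of the increment are conditionally centred given the past, and \<open>r\<close> is a function of the past.\<close>
  have rx: "expectation (\<lambda>\<omega>. x \<omega> * r \<omega>) = 0"
    using past_linear[OF b, of "\<lambda>h. dot p (psum b h) (psum b h) - real b * \<mu>" "psum b"]
      L2_mult_integrable[OF x r] by (simp add: x_def r_def)
  have ry: "expectation (\<lambda>\<omega>. y \<omega> * r \<omega>) = 0"
  proof -
    have "(\<lambda>x. dot p x x) \<in> borel_measurable (vec_space p)"
      by (rule borel_measurable_dot) (auto intro: measurable_component_singleton)
    note z = measurable_compose[OF measurable_snd this]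
    have "(\<lambda>h. dot p (psum b h) (psum b h)) \<in> borel_measurable (past_space b)"
      by (rule borel_measurable_dot) (auto intro: psum_measurable)
    note h = measurable_compose[OF measurable_fst this]
    have m: "(\<lambda>(h, z). (dot p z z - \<mu>) * (dot p (psum b h) (psum b h) - real b * \<mu>))
        \<in> borel_measurable (past_space b \<Otimes>\<^sub>M vec_space p)"
      unfolding case_prod_beta
      by (intro borel_measurable_times borel_measurable_diff borel_measurable_const z h)
    have "expectation (\<lambda>\<omega>. y \<omega> * r \<omega>) = (\<integral>\<omega>. (\<integral>\<omega>'. (dot p (w b \<omega>') (w b \<omega>') - \<mu>) * r \<omega> \<partial>M) \<partial>M)"
      using conditioning_on_past[OF b m] L2_mult_integrable[OF y r]
      unfolding y_def r_def split_conv by blast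
    also have "\<dots> = (\<integral>\<omega>. 0 \<partial>M)"
      by (intro Bochner_Integration.integral_cong refl)
        (simp add: L2_integrable[OF w_norm_L2[OF b]] w_norm_mean[OF b] prob_space)
    finally show ?thesis by simp
  qed
  have x2: "expectation (\<lambda>\<omega>. (x \<omega>)\<^sup>2) \<le> 4 * s\<^sup>2 * real p * real n"
  proof -
    have "s * \<mu> \<le> s * (2 * s * real p)" using \<mu>_le s_pos by (intro mult_left_mono) auto
    moreover have "s * t + t\<^sup>2 \<le> 2 * s * s"
      using st_le mult_left_mono[OF signal_le, of "2 * s"] s_pos by linarith
    moreover have "2 * s * s * 1 \<le> 2 * s * s * real p" using p_ge by (intro mult_left_mono) auto
    ultimately have "s * \<mu> + (s * t + t\<^sup>2) \<le> 4 * s\<^sup>2 * real p" by (simp add: power2_eq_square)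
    then have "real b * (s * \<mu> + (s * t + t\<^sup>2)) \<le> real n * (4 * s\<^sup>2 * real p)"
      using b \<mu>_nonneg t_nonneg s_pos by (intro mult_mono) auto
    then show ?thesis using w_S_second[OF b] by (simp add: x_def mult_ac)
  qed
  have y2: "expectation (\<lambda>\<omega>. (y \<omega>)\<^sup>2) \<le> K * s\<^sup>2 * (real p)\<^sup>2"
    unfolding y_def by (rule w_norm_variance[OF b])
  have "expectation (\<lambda>\<omega>. (2 * x \<omega> + y \<omega>)\<^sup>2) \<le> expectation (\<lambda>\<omega>. 8 * (x \<omega>)\<^sup>2 + 2 * (y \<omega>)\<^sup>2)"
  proof (rule integral_mono[OF L2_D(2)[OF xy]])
    show "integrable M (\<lambda>\<omega>. 8 * (x \<omega>)\<^sup>2 + 2 * (y \<omega>)\<^sup>2)" using L2_D(2)[OF x] L2_D(2)[OF y] by simp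
    show "(2 * x \<omega> + y \<omega>)\<^sup>2 \<le> 8 * (x \<omega>)\<^sup>2 + 2 * (y \<omega>)\<^sup>2" for \<omega>
      using power2_add_le[of "2 * x \<omega>" "y \<omega>"] by (simp add: power_mult_distrib)
  qed
  also have "\<dots> = 8 * expectation (\<lambda>\<omega>. (x \<omega>)\<^sup>2) + 2 * expectation (\<lambda>\<omega>. (y \<omega>)\<^sup>2)"
    using L2_D(2)[OF x] L2_D(2)[OF y] by simp
  finally have xy2: "expectation (\<lambda>\<omega>. (2 * x \<omega> + y \<omega>)\<^sup>2) \<le> 32 * s\<^sup>2 * real p * real n + 2 * K * s\<^sup>2 * (real p)\<^sup>2"
    using x2 y2 by simp
  have "expectation (\<lambda>\<omega>. (dot p (S (Suc b) \<omega>) (S (Suc b) \<omega>) - real (Suc b) * \<mu>)\<^sup>2) = expectation (\<lambda>\<omega>.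
      (r \<omega>)\<^sup>2 + (4 * (x \<omega> * r \<omega>) + 2 * (y \<omega> * r \<omega>)) + (2 * x \<omega> + y \<omega>)\<^sup>2)"
  proof (intro Bochner_Integration.integral_cong refl)
    fix \<omega>
    have "dot p (S (Suc b) \<omega>) (S (Suc b) \<omega>) - real (Suc b) * \<mu> = r \<omega> + (2 * x \<omega> + y \<omega>)"
      by (simp add: S_Suc dot_add_right dot_add_left dot_commute[of p "w b _" "S b _"] r_def x_def y_def algebra_simps)
    then show "(dot p (S (Suc b) \<omega>) (S (Suc b) \<omega>) - real (Suc b) * \<mu>)\<^sup>2
      = (r \<omega>)\<^sup>2 + (4 * (x \<omega> * r \<omega>) + 2 * (y \<omega> * r \<omega>)) + (2 * x \<omega> + y \<omega>)\<^sup>2"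
      by (simp add: power2_eq_square algebra_simps)
  qed
  also have "\<dots> = expectation (\<lambda>\<omega>. (r \<omega>)\<^sup>2) + expectation (\<lambda>\<omega>. (2 * x \<omega> + y \<omega>)\<^sup>2)"
    using L2_D(2)[OF r] L2_D(2)[OF xy] L2_mult_integrable[OF x r] L2_mult_integrable[OF y r]
    by (simp add: rx ry)
  also have "\<dots> \<le> real (Suc b) * (32 * s\<^sup>2 * real p * real n + 2 * K * s\<^sup>2 * (real p)\<^sup>2)"
    using Suc b xy2 by (simp add: r_def algebra_simps)
  finally show ?case .
qed

lemma S_norm_fourth:
  assumes "b \<le> n"
  shows "expectation (\<lambda>\<omega>. (dot p (S b \<omega>) (S b \<omega>))\<^sup>2) \<le> 76 * K * s\<^sup>2 * (real p)\<^sup>2 * (real n)\<^sup>2"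
proof -
  define r where "r \<omega> = dot p (S b \<omega>) (S b \<omega>) - real b * \<mu>" for \<omega>
  have r: "L2 M r" unfolding r_def using assms by (intro L2_diff L2_const S_norm_L2) auto
  have "expectation (\<lambda>\<omega>. (dot p (S b \<omega>) (S b \<omega>))\<^sup>2) \<le> expectation (\<lambda>\<omega>. 2 * (r \<omega>)\<^sup>2 + 2 * (real b * \<mu>)\<^sup>2)"
  proof (rule integral_mono[OF L2_D(2)[OF S_norm_L2[OF assms]]])
    show "integrable M (\<lambda>\<omega>. 2 * (r \<omega>)\<^sup>2 + 2 * (real b * \<mu>)\<^sup>2)" using L2_D(2)[OF r] by simp
    show "(dot p (S b \<omega>) (S b \<omega>))\<^sup>2 \<le> 2 * (r \<omega>)\<^sup>2 + 2 * (real b * \<mu>)\<^sup>2" for \<omega>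
      using power2_add_le[of "r \<omega>" "real b * \<mu>"] by (simp add: r_def)
  qed
  also have "\<dots> = 2 * expectation (\<lambda>\<omega>. (r \<omega>)\<^sup>2) + 2 * (real b * \<mu>)\<^sup>2"
    using L2_D(2)[OF r] by (simp add: prob_space)
  also have "\<dots> \<le> 2 * (real b * (32 * s\<^sup>2 * real p * real n + 2 * K * s\<^sup>2 * (real p)\<^sup>2)) + 2 * (real n * (2 * s * real p))\<^sup>2"
    using S_norm_variance[OF assms] \<mu>_le \<mu>_nonneg assms
    by (intro add_mono mult_left_mono power_mono mult_mono) (auto simp: r_def)
  also have "\<dots> \<le> 2 * (real n * (32 * s\<^sup>2 * (real p)\<^sup>2 * real n + 2 * K * s\<^sup>2 * (real p)\<^sup>2 * real n)) + 2 * (real n * (2 * s * real p))\<^sup>2"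
  proof (cases "n = 0")
    case True then show ?thesis using assms by simp
  next
    case False
    have "real p * 1 \<le> real p * real p" using p_ge by (intro mult_left_mono) auto
    then have "32 * s\<^sup>2 * real p * real n \<le> 32 * s\<^sup>2 * (real p)\<^sup>2 * real n"
      by (intro mult_right_mono mult_left_mono) (auto simp: power2_eq_square)
    moreover have "2 * K * s\<^sup>2 * (real p)\<^sup>2 * 1 \<le> 2 * K * s\<^sup>2 * (real p)\<^sup>2 * real n"
      using False K_ge by (intro mult_left_mono) auto
    ultimately have "32 * s\<^sup>2 * real p * real n + 2 * K * s\<^sup>2 * (real p)\<^sup>2
        \<le> 32 * s\<^sup>2 * (real p)\<^sup>2 * real n + 2 * K * s\<^sup>2 * (real p)\<^sup>2 * real n" by linarith
    then have "real b * (32 * s\<^sup>2 * real p * real n + 2 * K * s\<^sup>2 * (real p)\<^sup>2)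
        \<le> real n * (32 * s\<^sup>2 * (real p)\<^sup>2 * real n + 2 * K * s\<^sup>2 * (real p)\<^sup>2 * real n)"
      by (rule mult_mono[rotated]) (use assms K_ge in auto)
    then show ?thesis by linarith
  qed
  also have "\<dots> = (72 + 4 * K) * (s\<^sup>2 * (real p)\<^sup>2 * (real n)\<^sup>2)"
    by (simp add: power2_eq_square algebra_simps)
  also have "\<dots> \<le> (76 * K) * (s\<^sup>2 * (real p)\<^sup>2 * (real n)\<^sup>2)"
    using K_ge by (intro mult_right_mono) auto
  finally show ?thesis by (simp add: mult_ac)
qed

end

section \<open>The standardised martingale\<close>

text \<open>The variance \<open>\<psi>\<^sup>2\<close> in the form that separates its two sources: \<open>s\<^sup>2 p / n\<close> from the products of distinct
  scores and \<open>s t + t\<^sup>2 = \<beta>\<^sup>T (s I + \<beta> \<beta>\<^sup>T) \<beta>\<close> from the linear part. Each of them is bounded by \<open>\<psi>\<^sup>2\<close>, and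
  all estimates below are relative to \<open>\<psi>\<^sup>2\<close> through these two bounds.\<close>

locale scaled_score_sample = score_sample +
  fixes \<psi> :: real
  assumes psi_pos: "0 < \<psi>"
    and psi_sq: "\<psi>\<^sup>2 = 2 * s\<^sup>2 * real p / real n + 4 * (s * t + t\<^sup>2)"
    and n_ge: "2 \<le> n"
begin

definition N :: real where "N = real n - 1"

definition \<kappa> :: real where "\<kappa> = 2 / (sqrt (real n) * N * \<psi>)"

text \<open>The vector whose inner product with the score \<open>w b\<close> is, up to scaling, the increment of the estimator
  at time \<open>b\<close>: the walk so far together with the drift that collects all pairs containing \<open>b\<close>.\<close>

definition drifted_walk :: "nat \<Rightarrow> (nat \<Rightarrow> nat \<Rightarrow> real) \<Rightarrow> nat \<Rightarrow> real" where
  "drifted_walk b h j = psum b h j + N * \<beta> j"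

definition D :: "nat \<Rightarrow> 'a \<Rightarrow> real" where
  "D b \<omega> = \<kappa> * dot p (drifted_walk b (past b \<omega>)) (w b \<omega>)"

text \<open>The deterministic stand-in for the conditional variance of \<open>D b\<close>. It is the leading part of
  its expectation; terms of smaller order are left out so that the sum over \<open>b\<close> is simple.\<close>

definition nominal_var :: "nat \<Rightarrow> real" where
  "nominal_var b = \<kappa>\<^sup>2 * (s\<^sup>2 * real b * real p + N\<^sup>2 * (s * t + t\<^sup>2))"

lemma N_pos: "0 < N" and n_le_2N: "real n \<le> 2 * N" and n_pos: "0 < real n"
  using n_ge by (auto simp: N_def)

lemma kappa_sq: "\<kappa>\<^sup>2 = 4 / (real n * N\<^sup>2 * \<psi>\<^sup>2)"
  by (simp add: \<kappa>_def power_mult_distrib power_divide)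

lemma s2p_le: "s\<^sup>2 / \<psi>\<^sup>2 \<le> real n / (2 * real p)"
proof -
  have "2 * s\<^sup>2 * real p / real n \<le> \<psi>\<^sup>2" using psi_sq s_pos t_nonneg by simp
  then show ?thesis using psi_pos n_pos p_ge by (simp add: field_simps)
qed

lemma st_le_psi: "s * t / \<psi>\<^sup>2 \<le> 1 / 4"
proof -
  have "0 \<le> 2 * s\<^sup>2 * real p / real n" by simp
  then have "4 * (s * t) \<le> \<psi>\<^sup>2" using psi_sq by (simp add: field_simps)
  then show ?thesis using psi_pos by (simp add: field_simps)
qed

lemma inverse_N_sq_le: "1 / N\<^sup>2 \<le> 4 / (real n)\<^sup>2"
proof -
  have "(real n)\<^sup>2 \<le> (2 * N)\<^sup>2" using n_le_2N n_pos by (intro power_mono) auto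
  then show ?thesis using N_pos n_pos by (simp add: field_simps power_mult_distrib)
qed

lemma inverse_n_sq_le: "1 / (real n)\<^sup>2 \<le> 1 / real n * (1 / sqrt (real n))"
proof -
  have "real n * 1 \<le> real n * real n" using n_ge by (intro mult_left_mono) auto
  then have "sqrt (real n) \<le> real n" by (intro real_le_lsqrt) (auto simp: power2_eq_square)
  then have "1 / real n \<le> 1 / sqrt (real n)" using n_pos by (intro divide_left_mono) auto
  then have "1 / real n * (1 / real n) \<le> 1 / real n * (1 / sqrt (real n))"
    using n_pos by (intro mult_left_mono) auto
  then show ?thesis by (simp add: power2_eq_square)
qed

lemma nominal_var_nonneg: "0 \<le> nominal_var b"
  using s_pos t_nonneg by (simp add: nominal_var_def)

lemma nominal_var_le:
  assumes "b < n"
  shows "nominal_var b \<le> 10 / real n"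
proof -
  have "s\<^sup>2 * real b * real p + N\<^sup>2 * (s * t + t\<^sup>2) \<le> s\<^sup>2 * real n * real p + N\<^sup>2 * (2 * s * t)"
    using assms st_le by (intro add_mono mult_left_mono mult_right_mono) auto
  then have "nominal_var b \<le> \<kappa>\<^sup>2 * (s\<^sup>2 * real n * real p + N\<^sup>2 * (2 * s * t))"
    unfolding nominal_var_def by (rule mult_left_mono) simp
  also have "\<dots> = 4 * real p * (1 / N\<^sup>2) * (s\<^sup>2 / \<psi>\<^sup>2) + 8 / real n * (s * t / \<psi>\<^sup>2)"
    unfolding kappa_sq using N_pos n_pos psi_pos by (simp add: field_simps)
  also have "\<dots> \<le> 4 * real p * (4 / (real n)\<^sup>2) * (real n / (2 * real p)) + 8 / real n * (1 / 4)"
    using inverse_N_sq_le s2p_le st_le_psi n_pos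
    by (intro add_mono mult_left_mono mult_mono) auto
  also have "\<dots> = 10 / real n"
    using n_pos p_ge by (simp add: field_simps power2_eq_square)
  finally show ?thesis .
qed

text \<open>The sum is exactly \<open>(2 s\<^sup>2 p / (n - 1) + 4 (s t + t\<^sup>2)) / \<psi>\<^sup>2\<close>, which differs from 1 only in that
  \<open>n - 1\<close> has replaced \<open>n\<close>.\<close>

lemma sum_nominal_var: "\<bar>(\<Sum>b<n. nominal_var b) - 1\<bar> \<le> 2 / real n"
proof -
  have "(\<Sum>b<k. real b) = real k * (real k - 1) / 2" for k
    by (induction k) (auto simp: field_simps)
  then have g: "(\<Sum>b<n. real b) = real n * N / 2" by (simp add: N_def)
  have "(\<Sum>b<n. nominal_var b) = \<kappa>\<^sup>2 * (s\<^sup>2 * real p * (\<Sum>b<n. real b) + real n * (N\<^sup>2 * (s * t + t\<^sup>2)))"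
    unfolding nominal_var_def sum_distrib_left[symmetric] sum.distrib
    by (simp add: sum_distrib_left sum_distrib_right distrib_left mult_ac)
  also have "\<dots> = (2 * s\<^sup>2 * real p / N + 4 * (s * t + t\<^sup>2)) / \<psi>\<^sup>2"
    unfolding g kappa_sq using N_pos n_pos psi_pos by (simp add: field_simps power2_eq_square)
  also have "\<dots> = 1 + 2 * real p * (1 / N - 1 / real n) * (s\<^sup>2 / \<psi>\<^sup>2)"
  proof -
    have "2 * s\<^sup>2 * real p / N + 4 * (s * t + t\<^sup>2) = \<psi>\<^sup>2 + 2 * real p * (1 / N - 1 / real n) * s\<^sup>2"
      unfolding psi_sq by (simp add: algebra_simps)
    then show ?thesis using psi_pos by (simp add: add_divide_distrib)
  qed
  finally have e: "(\<Sum>b<n. nominal_var b) - 1 = 2 * real p * (1 / N - 1 / real n) * (s\<^sup>2 / \<psi>\<^sup>2)" by simp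
  have d: "1 / N - 1 / real n = 1 / (real n * N)" using N_pos n_pos by (simp add: N_def field_simps)
  have "2 * real p * (1 / (real n * N)) * (s\<^sup>2 / \<psi>\<^sup>2) \<le> 2 * real p * (1 / (real n * N)) * (real n / (2 * real p))"
    using s2p_le N_pos n_pos by (intro mult_left_mono) auto
  also have "\<dots> = 1 / N" using p_ge n_pos by (simp add: field_simps)
  also have "\<dots> \<le> 2 / real n" using n_le_2N N_pos n_pos by (simp add: field_simps)
  finally have "2 * real p * (1 / (real n * N)) * (s\<^sup>2 / \<psi>\<^sup>2) \<le> 2 / real n" .
  moreover have "0 \<le> 2 * real p * (1 / (real n * N)) * (s\<^sup>2 / \<psi>\<^sup>2)" using N_pos n_pos by simp
  ultimately show ?thesis unfolding e d by simp
qed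

lemma drifted_walk_measurable[measurable]:
  "a \<le> b \<Longrightarrow> j < p \<Longrightarrow> (\<lambda>h. drifted_walk a h j) \<in> borel_measurable (past_space b)"
  unfolding drifted_walk_def by (intro borel_measurable_add psum_measurable) auto

lemma drifted_walk_past: "a \<le> b \<Longrightarrow> drifted_walk a (past b \<omega>) = drifted_walk a (past a \<omega>)"
  by (simp add: fun_eq_iff drifted_walk_def psum_past)

lemma drifted_walk_L4: "b < n \<Longrightarrow> j < p \<Longrightarrow> L4 M (\<lambda>\<omega>. drifted_walk b (past b \<omega>) j)"
  unfolding drifted_walk_def by (intro L4_add L4_const S_L4) auto

lemma drifted_walk_norm_L2: "b < n \<Longrightarrow> L2 M (\<lambda>\<omega>. dot p (drifted_walk b (past b \<omega>)) (drifted_walk b (past b \<omega>)))"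
  by (intro L4_dot drifted_walk_L4)

lemma D_L4: "b < n \<Longrightarrow> L4 M (D b)"
  unfolding D_def by (intro L4_cmult past_fourth(1)[of b "drifted_walk b"] drifted_walk_norm_L2) auto

lemma drifted_walk_norm:
  "dot p (drifted_walk b h) (drifted_walk b h) = dot p (psum b h) (psum b h) + 2 * N * dot p \<beta> (psum b h) + N\<^sup>2 * t"
  unfolding drifted_walk_def
  by (simp only: dot_add_left dot_add_right dot_scale_left dot_scale_right dot_commute[of p "psum b h" \<beta>])
    (simp add: power2_eq_square algebra_simps)

lemma drifted_walk_signal: "dot p (drifted_walk b h) \<beta> = dot p \<beta> (psum b h) + N * t"
  unfolding drifted_walk_def by (simp only: dot_add_left dot_scale_left dot_commute[of p "psum b h" \<beta>])

lemma drifted_walk_norm_second: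
  assumes b: "b < n"
  shows "expectation (\<lambda>\<omega>. (dot p (drifted_walk b (past b \<omega>)) (drifted_walk b (past b \<omega>)))\<^sup>2)
    \<le> 608 * K * s\<^sup>2 * (real p)\<^sup>2 * (real n)\<^sup>2 + 8 * N ^ 4 * t\<^sup>2"
proof -
  have S: "L2 M (\<lambda>\<omega>. dot p (S b \<omega>) (S b \<omega>))" using b by (intro S_norm_L2) auto
  have "expectation (\<lambda>\<omega>. (dot p (drifted_walk b (past b \<omega>)) (drifted_walk b (past b \<omega>)))\<^sup>2)
      \<le> expectation (\<lambda>\<omega>. 8 * (dot p (S b \<omega>) (S b \<omega>))\<^sup>2 + 8 * N ^ 4 * t\<^sup>2)"
  proof (rule integral_mono[OF L2_D(2)[OF drifted_walk_norm_L2[OF b]]])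
    show "integrable M (\<lambda>\<omega>. 8 * (dot p (S b \<omega>) (S b \<omega>))\<^sup>2 + 8 * N ^ 4 * t\<^sup>2)"
      using L2_D(2)[OF S] by simp
    fix \<omega>
    let ?x = "dot p (drifted_walk b (past b \<omega>)) (drifted_walk b (past b \<omega>))" and ?q = "dot p (S b \<omega>) (S b \<omega>)"
    have "?x \<le> 2 * ?q + 2 * (N\<^sup>2 * t)"
    proof -
      have "(drifted_walk b (past b \<omega>) j)\<^sup>2 \<le> 2 * (S b \<omega> j)\<^sup>2 + 2 * (N\<^sup>2 * (\<beta> j)\<^sup>2)" for j
        using power2_add_le[of "S b \<omega> j" "N * \<beta> j"] by (simp add: drifted_walk_def power_mult_distrib)
      then have "(\<Sum>j<p. (drifted_walk b (past b \<omega>) j)\<^sup>2) \<le> (\<Sum>j<p. 2 * (S b \<omega> j)\<^sup>2 + 2 * (N\<^sup>2 * (\<beta> j)\<^sup>2))"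
        by (rule sum_mono)
      then show ?thesis
        by (simp add: dot_def power2_eq_square[symmetric] sum.distrib sum_distrib_left)
    qed
    then have "?x\<^sup>2 \<le> (2 * ?q + 2 * (N\<^sup>2 * t))\<^sup>2" by (intro power_mono dot_self_nonneg)
    also have "\<dots> \<le> 2 * (2 * ?q)\<^sup>2 + 2 * (2 * (N\<^sup>2 * t))\<^sup>2" by (rule power2_add_le)
    finally show "?x\<^sup>2 \<le> 8 * ?q\<^sup>2 + 8 * N ^ 4 * t\<^sup>2" by (simp add: power_mult_distrib)
  qed
  also have "\<dots> = 8 * expectation (\<lambda>\<omega>. (dot p (S b \<omega>) (S b \<omega>))\<^sup>2) + 8 * N ^ 4 * t\<^sup>2"
    using L2_D(2)[OF S] by (simp add: prob_space)
  also have "\<dots> \<le> 608 * K * s\<^sup>2 * (real p)\<^sup>2 * (real n)\<^sup>2 + 8 * N ^ 4 * t\<^sup>2"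
    using S_norm_fourth[of b] b by (simp add: mult_ac)
  finally show ?thesis .
qed

text \<open>The random walk and the drift each contribute at most order \<open>n\<^sup>2 \<psi>\<^sup>2 / s\<close> to the squared length,
  and \<open>\<kappa>\<^sup>2\<close> is of order \<open>1 / (n\<^sup>3 \<psi>\<^sup>2)\<close>. The powers of \<open>s\<close> and \<open>t\<close> are grouped into \<open>s\<^sup>2 / \<psi>\<^sup>2\<close> and \<open>s t / \<psi>\<^sup>2\<close> so that the two
  basic bounds can be inserted.\<close>

lemma D_fourth:
  assumes b: "b < n"
  shows "expectation (\<lambda>\<omega>. (D b \<omega>) ^ 4) \<le> 40000 * K\<^sup>2 / (real n)\<^sup>2"
proof -
  have "expectation (\<lambda>\<omega>. (D b \<omega>) ^ 4) = \<kappa> ^ 4 * expectation (\<lambda>\<omega>. (dot p (drifted_walk b (past b \<omega>)) (w b \<omega>)) ^ 4)"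
    by (simp add: D_def power_mult_distrib)
  also have "\<dots> \<le> \<kappa> ^ 4 * (K * s\<^sup>2 * (608 * K * s\<^sup>2 * (real p)\<^sup>2 * (real n)\<^sup>2 + 8 * N ^ 4 * t\<^sup>2))"
    by (intro mult_left_mono order_trans[OF past_fourth(2)[OF b, of "drifted_walk b"]] drifted_walk_norm_second b drifted_walk_norm_L2)
      (use K_ge b in auto)
  also have "\<dots> = 16 * 608 * K\<^sup>2 * (real p)\<^sup>2 * (1 / N\<^sup>2)\<^sup>2 * (s\<^sup>2 / \<psi>\<^sup>2)\<^sup>2 + 128 * K / (real n)\<^sup>2 * (s * t / \<psi>\<^sup>2)\<^sup>2"
  proof -
    have kappa_4: "\<kappa> ^ 4 = (4 / (real n * N\<^sup>2 * \<psi>\<^sup>2))\<^sup>2" unfolding kappa_sq[symmetric] by simp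
    show ?thesis unfolding kappa_4 using N_pos n_pos psi_pos
      by (simp add: field_simps power2_eq_square power4_eq_xxxx)
  qed
  also have "\<dots> \<le> 16 * 608 * K\<^sup>2 * (real p)\<^sup>2 * (4 / (real n)\<^sup>2)\<^sup>2 * (real n / (2 * real p))\<^sup>2 + 128 * K / (real n)\<^sup>2 * (1 / 4)\<^sup>2"
    using inverse_N_sq_le s2p_le st_le_psi K_ge s_pos t_nonneg
    by (intro add_mono mult_left_mono mult_mono power_mono) auto
  also have "\<dots> = (38912 * K\<^sup>2 + 8 * K) / (real n)\<^sup>2"
    using n_pos p_ge by (simp add: field_simps power2_eq_square)
  also have "\<dots> \<le> 40000 * K\<^sup>2 / (real n)\<^sup>2"
  proof -
    have "K * 1 \<le> K * K" using K_ge by (intro mult_left_mono) auto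
    then have "38912 * K\<^sup>2 + 8 * K \<le> 40000 * K\<^sup>2"
      using K_ge unfolding power2_eq_square by linarith
    then show ?thesis by (rule divide_right_mono) simp
  qed
  finally show ?thesis .
qed

text \<open>Third moments are interpolated: since \<open>D b\<close> is of order \<open>1 / \<surd>n\<close>, the inequality between the
  arithmetic and the geometric mean with this scale bounds \<open>\<bar>D\<bar>\<close> to the third power by a constant and the fourth
  power, both with the right order in \<open>n\<close>.\<close>

lemma D_third:
  assumes b: "b < n"
  shows "integrable M (\<lambda>\<omega>. \<bar>D b \<omega>\<bar> ^ 3)"
    and "expectation (\<lambda>\<omega>. \<bar>D b \<omega>\<bar> ^ 3) \<le> 40000 * K\<^sup>2 / (real n * sqrt (real n))"
proof -
  let ?r = "sqrt (real n)"
  have r: "0 < ?r" "?r * ?r = real n" using n_pos by auto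
  note [measurable] = L4_D(1)[OF D_L4[OF b]]
  have le: "\<bar>x\<bar> ^ 3 \<le> 1 / (4 * (real n * ?r)) + 3 * real n / (4 * ?r) * x ^ 4" for x :: real
  proof -
    \<comment> \<open>Multiply \<open>2 \<surd>n \<bar>x\<bar> \<le> 1 + n x\<^sup>2\<close> by \<open>x\<^sup>2\<close>, and then bound \<open>x\<^sup>2\<close> by \<open>2 n x\<^sup>2 \<le> 1 + n\<^sup>2 x\<^sup>4\<close>.\<close>
    have x3: "\<bar>x\<bar> ^ 3 = x\<^sup>2 * \<bar>x\<bar>" by (simp add: power3_eq_cube power2_eq_square abs_mult)
    have x4: "x ^ 4 = (x\<^sup>2)\<^sup>2" by simp
    have "2 * (?r * \<bar>x\<bar>) \<le> 1 + real n * x\<^sup>2"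
      using zero_le_power2[of "?r * \<bar>x\<bar> - 1"] r by (simp add: power2_diff power_mult_distrib)
    then have "x\<^sup>2 * (2 * (?r * \<bar>x\<bar>)) \<le> x\<^sup>2 * (1 + real n * x\<^sup>2)" by (rule mult_left_mono) simp
    then have a: "2 * ?r * \<bar>x\<bar> ^ 3 \<le> x\<^sup>2 + real n * x ^ 4"
      unfolding x3 x4 by (simp add: power2_eq_square algebra_simps)
    have c: "2 * real n * x\<^sup>2 \<le> 1 + (real n)\<^sup>2 * x ^ 4"
      using zero_le_power2[of "real n * x\<^sup>2 - 1"] unfolding x4 by (simp add: power2_diff power_mult_distrib)
    then have "2 * real n * (2 * ?r * \<bar>x\<bar> ^ 3) \<le> 2 * real n * (x\<^sup>2 + real n * x ^ 4)"
      using a by (intro mult_left_mono) auto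
    also have "\<dots> \<le> 1 + 3 * (real n)\<^sup>2 * x ^ 4" using c by (simp add: algebra_simps power2_eq_square)
    finally show ?thesis using r(1) n_pos by (simp add: field_simps power2_eq_square)
  qed
  have i4: "integrable M (\<lambda>\<omega>. 1 / (4 * (real n * ?r)) + 3 * real n / (4 * ?r) * (D b \<omega>) ^ 4)"
    using L4_D(2)[OF D_L4[OF b]] by simp
  show i3: "integrable M (\<lambda>\<omega>. \<bar>D b \<omega>\<bar> ^ 3)"
    by (rule Bochner_Integration.integrable_bound[OF i4])
      (use le in \<open>auto intro!: AE_I2 intro: order_trans[OF _ abs_ge_self]\<close>)
  have "expectation (\<lambda>\<omega>. \<bar>D b \<omega>\<bar> ^ 3) \<le> expectation (\<lambda>\<omega>. 1 / (4 * (real n * ?r)) + 3 * real n / (4 * ?r) * (D b \<omega>) ^ 4)"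
    by (rule integral_mono[OF i3 i4 le])
  also have "\<dots> = 1 / (4 * (real n * ?r)) + 3 * real n / (4 * ?r) * expectation (\<lambda>\<omega>. (D b \<omega>) ^ 4)"
    using L4_D(2)[OF D_L4[OF b]] by (simp add: prob_space)
  also have "\<dots> \<le> 1 / (4 * (real n * ?r)) + 3 * real n / (4 * ?r) * (40000 * K\<^sup>2 / (real n)\<^sup>2)"
    using r by (intro add_left_mono mult_left_mono D_fourth b) auto
  also have "\<dots> = (1 / 4 + 30000 * K\<^sup>2) / (real n * ?r)"
    using r(1) n_pos by (simp add: field_simps power2_eq_square)
  also have "\<dots> \<le> 40000 * K\<^sup>2 / (real n * ?r)"
  proof -
    have "1 \<le> K\<^sup>2" using K_ge by (simp add: one_le_power)
    then show ?thesis using r n_pos by (intro divide_right_mono) auto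
  qed
  finally show "expectation (\<lambda>\<omega>. \<bar>D b \<omega>\<bar> ^ 3) \<le> 40000 * K\<^sup>2 / (real n * ?r)" .
qed

text \<open>The partial sums of the increments, written as functions of the past so that \<open>exp (i u partial)\<close> is an
  admissible factor \<open>g\<close> in the conditioning lemmas.\<close>

definition partial :: "nat \<Rightarrow> (nat \<Rightarrow> nat \<Rightarrow> real) \<Rightarrow> real" where
  "partial b h = (\<Sum>a<b. \<kappa> * dot p (drifted_walk a h) (h a))"

lemma partial_measurable[measurable]: "partial b \<in> borel_measurable (past_space b)"
  unfolding partial_def[abs_def]
  by (intro borel_measurable_sum borel_measurable_times borel_measurable_const borel_measurable_dot) auto

lemma partial_past: "partial b (past b \<omega>) = (\<Sum>a<b. D a \<omega>)"
  unfolding partial_def D_def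
proof (intro sum.cong refl)
  fix a assume a: "a \<in> {..<b}"
  then have "past b \<omega> a = w a \<omega>" by (simp add: past_def)
  with drifted_walk_past[of a b \<omega>] a show "\<kappa> * dot p (drifted_walk a (past b \<omega>)) (past b \<omega> a) = \<kappa> * dot p (drifted_walk a (past a \<omega>)) (w a \<omega>)"
    by simp
qed

definition phase :: "real \<Rightarrow> nat \<Rightarrow> (nat \<Rightarrow> nat \<Rightarrow> real) \<Rightarrow> complex" where
  "phase u b h = iexp (u * partial b h)"

lemma phase_measurable[measurable]: "phase u b \<in> borel_measurable (past_space b)"
  unfolding phase_def[abs_def] by measurable

lemma phase_norm: "cmod (phase u b h) = 1"
  by (simp add: phase_def)

lemma phase_integrable:
  assumes "b \<le> n" "integrable M f"
  shows "integrable M (\<lambda>\<omega>. f \<omega> *\<^sub>R phase u b (past b \<omega>))"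
proof (rule Bochner_Integration.integrable_bound[OF assms(2)])
  have [measurable]: "past b \<in> measurable M (past_space b)" using assms by simp
  show "(\<lambda>\<omega>. f \<omega> *\<^sub>R phase u b (past b \<omega>)) \<in> borel_measurable M"
    using assms by measurable
qed (simp add: phase_norm)

lemma D_mean:
  assumes b: "b < n"
  shows "expectation (\<lambda>\<omega>. D b \<omega> *\<^sub>R phase u b (past b \<omega>)) = 0"
proof -
  have L: "L4 M (\<lambda>\<omega>. dot p (\<lambda>j. \<kappa> * drifted_walk b (past b \<omega>) j) (w b \<omega>))"
    using D_L4[OF b] by (simp add: D_def[abs_def] dot_scale_left)
  have "expectation (\<lambda>\<omega>. dot p (\<lambda>j. \<kappa> * drifted_walk b (past b \<omega>) j) (w b \<omega>) *\<^sub>R phase u b (past b \<omega>)) = 0"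
    by (rule past_linear[OF b, of _ "\<lambda>h j. \<kappa> * drifted_walk b h j"])
      (use b in \<open>auto intro!: phase_integrable L2_integrable L4_imp_L2 L\<close>)
  then show ?thesis by (simp add: D_def dot_scale_left)
qed

text \<open>With \<open>r = S\<^sup>T S - b \<mu>\<close> and \<open>x = \<beta>\<^sup>T S\<close>, the conditional variance minus its stand-in equals
  \<open>\<kappa>\<^sup>2 (s r + s b t + 2 (n - 1) (s + t) x + x\<^sup>2)\<close>. The four terms are bounded separately (facts \<open>R\<close>, \<open>B\<close>, \<open>X\<close>,
  \<open>X2\<close>). The first and the third one give rise to \<open>1 / \<surd>p\<close>. The third is the interaction of signal and
  noise; it is of order \<open>s \<surd>(s t / n) / (n \<psi>\<^sup>2)\<close>, and \<open>s \<surd>(s t / n)\<close> is compared with \<open>\<psi>\<^sup>2\<close> by using both lower bounds for \<open>\<psi>\<^sup>2\<close> at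
  once, through their geometric mean.\<close>

lemma conditional_variance_error:
  assumes b: "b < n"
  shows "expectation (\<lambda>\<omega>. \<bar>\<kappa>\<^sup>2 * (s * dot p (drifted_walk b (past b \<omega>)) (drifted_walk b (past b \<omega>)) + (dot p (drifted_walk b (past b \<omega>)) \<beta>)\<^sup>2) - nominal_var b\<bar>)
    \<le> 64 * K / real n * (1 / sqrt (real p) + 1 / sqrt (real n))"
proof -
  define r where "r \<omega> = dot p (S b \<omega>) (S b \<omega>) - real b * \<mu>" for \<omega>
  define x where "x \<omega> = dot p \<beta> (S b \<omega>)" for \<omega>
  have bn: "real b \<le> real n" "b \<le> n" using b by auto
  have r: "L2 M r" unfolding r_def using bn by (intro L2_diff L2_const S_norm_L2) auto
  have x: "L2 M x" unfolding x_def using bn by (intro L4_imp_L2 S_dot_L4) auto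
  let ?P = "sqrt (real p)" and ?Q = "sqrt (real n)"
  have P: "0 < ?P" "?P * ?P = real p" and Q: "0 < ?Q" "?Q * ?Q = real n" using p_ge n_pos by auto
  have ratio_nonneg: "0 \<le> s\<^sup>2 / \<psi>\<^sup>2" "0 \<le> s * t / \<psi>\<^sup>2" using s_pos t_nonneg by auto
  have R: "\<kappa>\<^sup>2 * s * expectation (\<lambda>\<omega>. \<bar>r \<omega>\<bar>) \<le> 48 * K / real n * (1 / ?P + 1 / ?Q)"
  proof -
    have "expectation (\<lambda>\<omega>. \<bar>r \<omega>\<bar>) \<le> sqrt (real b * (32 * s\<^sup>2 * real p * real n + 2 * K * s\<^sup>2 * (real p)\<^sup>2))"
      using S_norm_variance[OF bn(2)] by (intro expectation_abs_le_sqrt r) (simp add: r_def)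
    also have "\<dots> \<le> 6 * K * s * (real n * ?P + real p * ?Q)"
    proof (rule real_le_lsqrt)
      show "0 \<le> 6 * K * s * (real n * ?P + real p * ?Q)" using K_ge s_pos by simp
      have "real b * (32 * s\<^sup>2 * real p * real n + 2 * K * s\<^sup>2 * (real p)\<^sup>2)
          \<le> real n * (32 * s\<^sup>2 * real p * real n + 2 * K * s\<^sup>2 * (real p)\<^sup>2)"
        using bn K_ge by (intro mult_right_mono) auto
      also have "\<dots> = s\<^sup>2 * (32 * ((real n)\<^sup>2 * real p) + 2 * K * ((real p)\<^sup>2 * real n))"
        by (simp add: power2_eq_square algebra_simps)
      also have "\<dots> \<le> s\<^sup>2 * (36 * K\<^sup>2 * ((real n)\<^sup>2 * real p) + 36 * K\<^sup>2 * ((real p)\<^sup>2 * real n))"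
      proof -
        have "1 * 1 \<le> K * K" "K * 1 \<le> K * K" using K_ge by (intro mult_mono mult_left_mono; simp)+
        then have "32 \<le> 36 * K\<^sup>2" "2 * K \<le> 36 * K\<^sup>2"
          using K_ge unfolding power2_eq_square by linarith+
        then show ?thesis by (intro mult_left_mono add_mono mult_right_mono) auto
      qed
      also have "\<dots> \<le> s\<^sup>2 * (36 * K\<^sup>2 * ((real n)\<^sup>2 * real p + (real p)\<^sup>2 * real n + 2 * (real n * ?P) * (real p * ?Q)))"
        by (intro mult_left_mono) (auto simp: algebra_simps)
      also have "\<dots> = (6 * K * s * (real n * ?P + real p * ?Q))\<^sup>2"
        using P(2) Q(2) by (simp add: power_mult_distrib power2_sum)
      finally show "real b * (32 * s\<^sup>2 * real p * real n + 2 * K * s\<^sup>2 * (real p)\<^sup>2) \<le> (6 * K * s * (real n * ?P + real p * ?Q))\<^sup>2" .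
    qed
    finally have "\<kappa>\<^sup>2 * s * expectation (\<lambda>\<omega>. \<bar>r \<omega>\<bar>) \<le> \<kappa>\<^sup>2 * s * (6 * K * s * (real n * ?P + real p * ?Q))"
      using s_pos by (intro mult_left_mono) auto
    also have "\<dots> = 24 * K * (real n * ?P + real p * ?Q) / real n * ((1 / N\<^sup>2) * (s\<^sup>2 / \<psi>\<^sup>2))"
      unfolding kappa_sq by (simp add: power2_eq_square mult_ac)
    also have "\<dots> \<le> 24 * K * (real n * ?P + real p * ?Q) / real n * ((4 / (real n)\<^sup>2) * (real n / (2 * real p)))"
      using inverse_N_sq_le s2p_le K_ge ratio_nonneg by (intro mult_left_mono mult_mono) auto
    also have "\<dots> = 48 * K / real n * (?P / real p + ?Q / real n)"
      using p_ge n_pos by (simp add: field_simps power2_eq_square)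
    also have "?P / real p = 1 / ?P" using P by (simp add: field_simps)
    also have "?Q / real n = 1 / ?Q" using Q by (simp add: field_simps)
    finally show ?thesis .
  qed
  have B: "\<kappa>\<^sup>2 * (s * real b * t) \<le> 4 / real n * (1 / ?Q)"
  proof -
    have "\<kappa>\<^sup>2 * (s * real b * t) \<le> \<kappa>\<^sup>2 * (s * real n * t)"
      using bn s_pos t_nonneg by (intro mult_left_mono mult_right_mono) auto
    also have "\<dots> = 4 * (1 / N\<^sup>2) * (s * t / \<psi>\<^sup>2)" unfolding kappa_sq using n_pos by simp
    also have "\<dots> \<le> 4 * (4 / (real n)\<^sup>2) * (1 / 4)"
      using inverse_N_sq_le st_le_psi ratio_nonneg by (intro mult_left_mono mult_mono) auto
    also have "\<dots> \<le> 4 / real n * (1 / ?Q)" using inverse_n_sq_le by simp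
    finally show ?thesis .
  qed
  have X: "\<kappa>\<^sup>2 * (2 * N * (s + t)) * expectation (\<lambda>\<omega>. \<bar>x \<omega>\<bar>) \<le> 16 / real n * (1 / ?P)"
  proof -
    have "real b * (s * t + t\<^sup>2) \<le> real n * (2 * s * t)"
      using bn st_le s_pos t_nonneg by (intro mult_mono) auto
    then have "expectation (\<lambda>\<omega>. (x \<omega>)\<^sup>2) \<le> real n * (2 * s * t)"
      using dot_S_second[OF bn(2)] by (simp add: x_def)
    then have "expectation (\<lambda>\<omega>. \<bar>x \<omega>\<bar>) \<le> sqrt (real n * (2 * s * t))"
      by (intro expectation_abs_le_sqrt x)
    then have "(s + t) * expectation (\<lambda>\<omega>. \<bar>x \<omega>\<bar>) \<le> (2 * s) * sqrt (real n * (2 * s * t))"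
      using signal_le s_pos t_nonneg by (intro mult_mono) auto
    also have "\<dots> \<le> real n * \<psi>\<^sup>2 / ?P"
    proof -
      have "(s\<^sup>2 / \<psi>\<^sup>2) * (s * t / \<psi>\<^sup>2) \<le> (real n / (2 * real p)) * (1 / 4)"
        using s2p_le st_le_psi ratio_nonneg by (intro mult_mono) auto
      then have "8 * real n * (\<psi>\<^sup>2)\<^sup>2 * ((s\<^sup>2 / \<psi>\<^sup>2) * (s * t / \<psi>\<^sup>2)) \<le> 8 * real n * (\<psi>\<^sup>2)\<^sup>2 * ((real n / (2 * real p)) * (1 / 4))"
        by (intro mult_left_mono) auto
      also have "\<dots> = (real n * \<psi>\<^sup>2 / ?P)\<^sup>2"
        using P n_pos by (simp add: power_divide power_mult_distrib power2_eq_square)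
      also have "8 * real n * (\<psi>\<^sup>2)\<^sup>2 * ((s\<^sup>2 / \<psi>\<^sup>2) * (s * t / \<psi>\<^sup>2)) = 8 * real n * (s\<^sup>2 * (s * t))"
        using psi_pos by (simp add: power2_eq_square)
      finally have "8 * real n * (s\<^sup>2 * (s * t)) \<le> (real n * \<psi>\<^sup>2 / ?P)\<^sup>2" .
      then have "sqrt (8 * real n * (s\<^sup>2 * (s * t))) \<le> real n * \<psi>\<^sup>2 / ?P"
        by (intro real_le_lsqrt) auto
      also have "8 * real n * (s\<^sup>2 * (s * t)) = (2 * s)\<^sup>2 * (real n * (2 * s * t))" by (simp add: power2_eq_square)
      finally show ?thesis
        unfolding real_sqrt_mult[of "(2 * s)\<^sup>2"] real_sqrt_abs using s_pos by simp
    qed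
    finally have "\<kappa>\<^sup>2 * (2 * N) * ((s + t) * expectation (\<lambda>\<omega>. \<bar>x \<omega>\<bar>)) \<le> \<kappa>\<^sup>2 * (2 * N) * (real n * \<psi>\<^sup>2 / ?P)"
      using N_pos by (intro mult_left_mono) auto
    also have "\<dots> = 8 / ?P * (1 / N)"
      unfolding kappa_sq using N_pos n_pos psi_pos by (simp add: field_simps power2_eq_square)
    also have "\<dots> \<le> 8 / ?P * (2 / real n)"
      using n_le_2N N_pos n_pos P by (intro mult_left_mono) (auto simp: field_simps)
    also have "\<dots> = 16 / real n * (1 / ?P)" by simp
    finally show ?thesis by (simp only: mult.assoc)
  qed
  have X2: "\<kappa>\<^sup>2 * expectation (\<lambda>\<omega>. (x \<omega>)\<^sup>2) \<le> 8 / real n * (1 / ?Q)"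
  proof -
    have "real b * (s * t + t\<^sup>2) \<le> real n * (2 * s * t)"
      using bn st_le s_pos t_nonneg by (intro mult_mono) auto
    then have "\<kappa>\<^sup>2 * expectation (\<lambda>\<omega>. (x \<omega>)\<^sup>2) \<le> \<kappa>\<^sup>2 * (real n * (2 * s * t))"
      using dot_S_second[OF bn(2)] by (intro mult_left_mono) (simp_all add: x_def)
    also have "\<dots> = 8 * (1 / N\<^sup>2) * (s * t / \<psi>\<^sup>2)" unfolding kappa_sq using n_pos by simp
    also have "\<dots> \<le> 8 * (4 / (real n)\<^sup>2) * (1 / 4)"
      using inverse_N_sq_le st_le_psi ratio_nonneg by (intro mult_left_mono mult_mono) auto
    also have "\<dots> \<le> 8 / real n * (1 / ?Q)" using inverse_n_sq_le by simp
    finally show ?thesis .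
  qed
  have i: "integrable M (\<lambda>\<omega>. \<bar>r \<omega>\<bar>)" "integrable M (\<lambda>\<omega>. \<bar>x \<omega>\<bar>)" "integrable M (\<lambda>\<omega>. (x \<omega>)\<^sup>2)"
    using L2_integrable[OF r] L2_integrable[OF x] L2_D(2)[OF x] by auto
  have e: "\<kappa>\<^sup>2 * (s * dot p (drifted_walk b (past b \<omega>)) (drifted_walk b (past b \<omega>)) + (dot p (drifted_walk b (past b \<omega>)) \<beta>)\<^sup>2) - nominal_var b
      = \<kappa>\<^sup>2 * s * r \<omega> + \<kappa>\<^sup>2 * (s * real b * t) + \<kappa>\<^sup>2 * (2 * N * (s + t)) * x \<omega> + \<kappa>\<^sup>2 * (x \<omega>)\<^sup>2" for \<omega>
    unfolding drifted_walk_norm drifted_walk_signal nominal_var_def r_def x_def \<mu>_def by (simp add: power2_eq_square algebra_simps)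
  have "expectation (\<lambda>\<omega>. \<bar>\<kappa>\<^sup>2 * s * r \<omega> + \<kappa>\<^sup>2 * (s * real b * t) + \<kappa>\<^sup>2 * (2 * N * (s + t)) * x \<omega> + \<kappa>\<^sup>2 * (x \<omega>)\<^sup>2\<bar>)
     \<le> expectation (\<lambda>\<omega>. \<kappa>\<^sup>2 * s * \<bar>r \<omega>\<bar> + \<kappa>\<^sup>2 * (s * real b * t) + \<kappa>\<^sup>2 * (2 * N * (s + t)) * \<bar>x \<omega>\<bar> + \<kappa>\<^sup>2 * (x \<omega>)\<^sup>2)"
  proof (rule integral_mono)
    show "integrable M (\<lambda>\<omega>. \<bar>\<kappa>\<^sup>2 * s * r \<omega> + \<kappa>\<^sup>2 * (s * real b * t) + \<kappa>\<^sup>2 * (2 * N * (s + t)) * x \<omega> + \<kappa>\<^sup>2 * (x \<omega>)\<^sup>2\<bar>)"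
      using L2_integrable[OF r] L2_integrable[OF x] L2_D(2)[OF x] by simp
    show "integrable M (\<lambda>\<omega>. \<kappa>\<^sup>2 * s * \<bar>r \<omega>\<bar> + \<kappa>\<^sup>2 * (s * real b * t) + \<kappa>\<^sup>2 * (2 * N * (s + t)) * \<bar>x \<omega>\<bar> + \<kappa>\<^sup>2 * (x \<omega>)\<^sup>2)"
      using i by simp
    fix \<omega>
    have "\<bar>\<kappa>\<^sup>2 * s * r \<omega>\<bar> = \<kappa>\<^sup>2 * s * \<bar>r \<omega>\<bar>" "\<bar>\<kappa>\<^sup>2 * (s * real b * t)\<bar> = \<kappa>\<^sup>2 * (s * real b * t)"
      "\<bar>\<kappa>\<^sup>2 * (2 * N * (s + t)) * x \<omega>\<bar> = \<kappa>\<^sup>2 * (2 * N * (s + t)) * \<bar>x \<omega>\<bar>" "\<bar>\<kappa>\<^sup>2 * (x \<omega>)\<^sup>2\<bar> = \<kappa>\<^sup>2 * (x \<omega>)\<^sup>2"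
      using s_pos t_nonneg N_pos by (auto simp: abs_mult)
    then show "\<bar>\<kappa>\<^sup>2 * s * r \<omega> + \<kappa>\<^sup>2 * (s * real b * t) + \<kappa>\<^sup>2 * (2 * N * (s + t)) * x \<omega> + \<kappa>\<^sup>2 * (x \<omega>)\<^sup>2\<bar>
      \<le> \<kappa>\<^sup>2 * s * \<bar>r \<omega>\<bar> + \<kappa>\<^sup>2 * (s * real b * t) + \<kappa>\<^sup>2 * (2 * N * (s + t)) * \<bar>x \<omega>\<bar> + \<kappa>\<^sup>2 * (x \<omega>)\<^sup>2"
      by linarith
  qed
  also have "\<dots> = \<kappa>\<^sup>2 * s * expectation (\<lambda>\<omega>. \<bar>r \<omega>\<bar>) + \<kappa>\<^sup>2 * (s * real b * t)
      + \<kappa>\<^sup>2 * (2 * N * (s + t)) * expectation (\<lambda>\<omega>. \<bar>x \<omega>\<bar>) + \<kappa>\<^sup>2 * expectation (\<lambda>\<omega>. (x \<omega>)\<^sup>2)"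
    using i by (simp add: prob_space)
  also have "\<dots> \<le> 48 * K / real n * (1 / ?P + 1 / ?Q) + 4 / real n * (1 / ?Q) + 16 / real n * (1 / ?P) + 8 / real n * (1 / ?Q)"
    by (intro add_mono R B X X2)
  also have "\<dots> \<le> 64 * K / real n * (1 / ?P + 1 / ?Q)"
  proof -
    define a c where "a = 1 / real n * (1 / ?P)" and "c = 1 / real n * (1 / ?Q)"
    have "0 \<le> a" "0 \<le> c" using P Q n_pos by (auto simp: a_def c_def)
    then have "1 * a \<le> K * a" "1 * c \<le> K * c" using K_ge by (intro mult_right_mono; simp)+
    then have "48 * (K * a) + 48 * (K * c) + 4 * c + 16 * a + 8 * c \<le> 64 * (K * a) + 64 * (K * c)"
      using \<open>0 \<le> a\<close> \<open>0 \<le> c\<close> by linarith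
    then show ?thesis by (simp add: a_def c_def distrib_left)
  qed
  finally show ?thesis unfolding e .
qed

lemma D_variance:
  assumes b: "b < n"
  shows "cmod (expectation (\<lambda>\<omega>. ((D b \<omega>)\<^sup>2 - nominal_var b) *\<^sub>R phase u b (past b \<omega>)))
    \<le> 64 * K / real n * (1 / sqrt (real p) + 1 / sqrt (real n))"
proof -
  define V where "V \<omega> = \<kappa>\<^sup>2 * (s * dot p (drifted_walk b (past b \<omega>)) (drifted_walk b (past b \<omega>)) + (dot p (drifted_walk b (past b \<omega>)) \<beta>)\<^sup>2)" for \<omega>
  have bn: "b \<le> n" using b by simp
  have V_int: "integrable M V"
    unfolding V_def using L2_integrable[OF drifted_walk_norm_L2[OF b]]
      L2_D(2)[OF L4_imp_L2[OF L4_dot_const[of p "\<lambda>\<omega>. drifted_walk b (past b \<omega>)" \<beta>, OF drifted_walk_L4[OF b]]]]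
    by (simp add: dot_commute[of p \<beta>])
  have D_int: "integrable M (\<lambda>\<omega>. (D b \<omega>)\<^sup>2)" by (intro L2_D(2) L4_imp_L2 D_L4 b)
  have D_eq: "(D b \<omega>)\<^sup>2 = (dot p (\<lambda>j. \<kappa> * drifted_walk b (past b \<omega>) j) (w b \<omega>))\<^sup>2" for \<omega>
    by (simp add: D_def dot_scale_left)
  have V_eq: "V \<omega> = s * dot p (\<lambda>j. \<kappa> * drifted_walk b (past b \<omega>) j) (\<lambda>j. \<kappa> * drifted_walk b (past b \<omega>) j)
      + (dot p (\<lambda>j. \<kappa> * drifted_walk b (past b \<omega>) j) \<beta>)\<^sup>2" for \<omega>
    by (simp add: V_def dot_scale_left dot_scale_right power2_eq_square algebra_simps)
  have "expectation (\<lambda>\<omega>. (D b \<omega>)\<^sup>2 *\<^sub>R phase u b (past b \<omega>)) = expectation (\<lambda>\<omega>. V \<omega> *\<^sub>R phase u b (past b \<omega>))"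
    using phase_integrable[OF bn D_int, of u] unfolding D_eq V_eq
    by (intro past_square[OF b, of "phase u b" "\<lambda>h j. \<kappa> * drifted_walk b h j"]) auto
  then have eq: "expectation (\<lambda>\<omega>. ((D b \<omega>)\<^sup>2 - nominal_var b) *\<^sub>R phase u b (past b \<omega>))
      = expectation (\<lambda>\<omega>. (V \<omega> - nominal_var b) *\<^sub>R phase u b (past b \<omega>))"
    using phase_integrable[OF bn D_int, of u] phase_integrable[OF bn V_int, of u] phase_integrable[OF bn, of "\<lambda>_. nominal_var b" u]
    by (simp add: scaleR_diff_left)
  have "cmod (expectation (\<lambda>\<omega>. (V \<omega> - nominal_var b) *\<^sub>R phase u b (past b \<omega>)))
      \<le> expectation (\<lambda>\<omega>. cmod ((V \<omega> - nominal_var b) *\<^sub>R phase u b (past b \<omega>)))"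
    by (rule integral_norm_bound)
  also have "\<dots> = expectation (\<lambda>\<omega>. \<bar>V \<omega> - nominal_var b\<bar>)" by (simp add: phase_norm)
  also have "\<dots> \<le> 64 * K / real n * (1 / sqrt (real p) + 1 / sqrt (real n))"
    unfolding V_def by (rule conditional_variance_error[OF b])
  finally show ?thesis unfolding eq .
qed

text \<open>A bound for the distance to the normal characteristic function for each \<open>n\<close> and \<open>p\<close>. The model enters
  only through the constant \<open>K\<close>, so the bound is uniform in \<open>\<beta>\<close>, \<open>s\<close> and \<open>\<psi>\<close>.\<close>

lemma char_near_normal:
  "cmod (expectation (\<lambda>\<omega>. iexp (u * (\<Sum>b<n. D b \<omega>))) - of_real (exp (- (u\<^sup>2 / 2))))
    \<le> 32 * K * u\<^sup>2 * (1 / sqrt (real p) + 1 / sqrt (real n)) + 7000 * K\<^sup>2 * \<bar>u\<bar> ^ 3 / sqrt (real n) + 13 * u ^ 4 / real n + u\<^sup>2 / real n"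
proof -
  let ?\<delta> = "64 * K / real n * (1 / sqrt (real p) + 1 / sqrt (real n))"
  let ?\<eta> = "40000 * K\<^sup>2 / (real n * sqrt (real n))"
  have ph: "iexp (u * (\<Sum>k<b. D k \<omega>)) = phase u b (past b \<omega>)" for b \<omega>
    by (simp add: phase_def partial_past)
  have "cmod (expectation (\<lambda>\<omega>. iexp (u * (\<Sum>b<n. D b \<omega>))) - of_real (exp (- (u\<^sup>2 / 2) * (\<Sum>b<n. nominal_var b))))
    \<le> (\<Sum>b<n. u\<^sup>2 / 2 * ?\<delta> + \<bar>u\<bar> ^ 3 / 6 * ?\<eta> + u ^ 4 / 8 * (nominal_var b)\<^sup>2)"
  proof (rule char_sum_near_normal)
    fix b assume b: "b < n"
    show "D b \<in> borel_measurable M" using L4_D(1)[OF D_L4[OF b]] .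
    show "integrable M (\<lambda>\<omega>. (D b \<omega>)\<^sup>2)" by (intro L2_D(2) L4_imp_L2 D_L4 b)
    show "integrable M (\<lambda>\<omega>. \<bar>D b \<omega>\<bar> ^ 3)" "expectation (\<lambda>\<omega>. \<bar>D b \<omega>\<bar> ^ 3) \<le> ?\<eta>" by (rule D_third[OF b])+
    show "0 \<le> nominal_var b" by (rule nominal_var_nonneg)
    show "expectation (\<lambda>\<omega>. D b \<omega> *\<^sub>R iexp (u * (\<Sum>k<b. D k \<omega>))) = 0"
      unfolding ph by (rule D_mean[OF b])
    show "cmod (expectation (\<lambda>\<omega>. ((D b \<omega>)\<^sup>2 - nominal_var b) *\<^sub>R iexp (u * (\<Sum>k<b. D k \<omega>)))) \<le> ?\<delta>"
      unfolding ph by (rule D_variance[OF b])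
  qed
  also have "\<dots> \<le> (\<Sum>b<n. u\<^sup>2 / 2 * ?\<delta> + \<bar>u\<bar> ^ 3 / 6 * ?\<eta> + u ^ 4 / 8 * (10 / real n)\<^sup>2)"
    by (intro sum_mono add_left_mono mult_left_mono power_mono nominal_var_le nominal_var_nonneg) auto
  also have "\<dots> = 32 * K * u\<^sup>2 * (1 / sqrt (real p) + 1 / sqrt (real n)) + 40000 / 6 * (K\<^sup>2 * \<bar>u\<bar> ^ 3 / sqrt (real n)) + 100 / 8 * (u ^ 4 / real n)"
    using n_pos by (simp add: field_simps power2_eq_square)
  also have "\<dots> \<le> 32 * K * u\<^sup>2 * (1 / sqrt (real p) + 1 / sqrt (real n)) + 7000 * (K\<^sup>2 * \<bar>u\<bar> ^ 3 / sqrt (real n)) + 13 * (u ^ 4 / real n)"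
    by (intro add_mono mult_right_mono order_refl) auto
  finally have main: "cmod (expectation (\<lambda>\<omega>. iexp (u * (\<Sum>b<n. D b \<omega>))) - of_real (exp (- (u\<^sup>2 / 2) * (\<Sum>b<n. nominal_var b))))
    \<le> 32 * K * u\<^sup>2 * (1 / sqrt (real p) + 1 / sqrt (real n)) + 7000 * K\<^sup>2 * \<bar>u\<bar> ^ 3 / sqrt (real n) + 13 * u ^ 4 / real n"
    by simp
  have "cmod (of_real (exp (- (u\<^sup>2 / 2) * (\<Sum>b<n. nominal_var b))) - of_real (exp (- (u\<^sup>2 / 2))))
      = \<bar>exp (- (u\<^sup>2 / 2 * (\<Sum>b<n. nominal_var b))) - exp (- (u\<^sup>2 / 2))\<bar>"
    unfolding of_real_diff[symmetric] norm_of_real by simp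
  also have "\<dots> \<le> \<bar>u\<^sup>2 / 2 * (\<Sum>b<n. nominal_var b) - u\<^sup>2 / 2\<bar>"
    by (rule exp_neg_contraction) (auto intro!: mult_nonneg_nonneg sum_nonneg nominal_var_nonneg)
  also have "\<dots> = u\<^sup>2 / 2 * \<bar>(\<Sum>b<n. nominal_var b) - 1\<bar>"
    using abs_mult[of "u\<^sup>2 / 2" "(\<Sum>b<n. nominal_var b) - 1"] by (simp add: right_diff_distrib)
  also have "\<dots> \<le> u\<^sup>2 / 2 * (2 / real n)" by (intro mult_left_mono sum_nominal_var) auto
  finally have "cmod (of_real (exp (- (u\<^sup>2 / 2) * (\<Sum>b<n. nominal_var b))) - of_real (exp (- (u\<^sup>2 / 2)))) \<le> u\<^sup>2 / real n"
    by simp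
  from norm_diff_triangle_le[OF main this] show ?thesis .
qed

end

section \<open>Moments of normal variables\<close>

lemma (in prob_space) centered_normal_moment:
  assumes Z: "distributed M lborel Z (normal_density 0 \<rho>)" and \<rho>: "0 < \<rho>"
  shows "integrable M (\<lambda>\<omega>. (Z \<omega>) ^ (2 * k))"
    and "expectation (\<lambda>\<omega>. (Z \<omega>) ^ (2 * k)) = (\<rho>\<^sup>2) ^ k * (fact (2 * k) / (2 ^ k * fact k))"
proof -
  have h: "has_bochner_integral lborel (\<lambda>x. normal_density 0 \<rho> x * x ^ (2 * k)) (fact (2 * k) / ((2 / \<rho>\<^sup>2) ^ k * fact k))"
    using normal_moment_even[OF \<rho>, of 0 k] by simp
  show "integrable M (\<lambda>\<omega>. (Z \<omega>) ^ (2 * k))"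
    using distributed_integrable[OF Z, of "\<lambda>x. x ^ (2 * k)"] h by (simp add: has_bochner_integral_iff)
  have "expectation (\<lambda>\<omega>. (Z \<omega>) ^ (2 * k)) = fact (2 * k) / ((2 / \<rho>\<^sup>2) ^ k * fact k)"
    using distributed_integral[OF Z, of "\<lambda>x. x ^ (2 * k)"] h by (simp add: has_bochner_integral_iff)
  then show "expectation (\<lambda>\<omega>. (Z \<omega>) ^ (2 * k)) = (\<rho>\<^sup>2) ^ k * (fact (2 * k) / (2 ^ k * fact k))"
    using \<rho> by (simp add: power_divide field_simps)
qed

text \<open>The formula covers the point mass at 0, whose moments of positive order vanish.\<close>

lemma (in prob_space) normal_law_moment:
  assumes [measurable]: "Z \<in> borel_measurable M"
    and law: "distr M borel Z = normal_law \<rho>" and \<rho>: "0 \<le> \<rho>" and k: "0 < k"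
  shows "integrable M (\<lambda>\<omega>. (Z \<omega>) ^ (2 * k))"
    and "expectation (\<lambda>\<omega>. (Z \<omega>) ^ (2 * k)) = (\<rho>\<^sup>2) ^ k * (fact (2 * k) / (2 ^ k * fact k))"
proof -
  have "integrable M (\<lambda>\<omega>. (Z \<omega>) ^ (2 * k)) \<and>
    expectation (\<lambda>\<omega>. (Z \<omega>) ^ (2 * k)) = (\<rho>\<^sup>2) ^ k * (fact (2 * k) / (2 ^ k * fact k))"
  proof (cases "\<rho> = 0")
    case True
    have point_mass: "normal_law \<rho> = return borel 0" by (simp add: normal_law_def True)
    have "AE x in distr M borel Z. x = 0"
      unfolding law point_mass by (subst AE_return) auto
    then have ae: "AE \<omega> in M. (Z \<omega>) ^ (2 * k) = 0"
      by (subst (asm) AE_distr_iff) (use k in auto)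
    then have "integrable M (\<lambda>\<omega>. (Z \<omega>) ^ (2 * k)) \<longleftrightarrow> integrable M (\<lambda>\<omega>. 0 :: real)"
      by (intro integrable_cong_AE) auto
    moreover have "expectation (\<lambda>\<omega>. (Z \<omega>) ^ (2 * k)) = expectation (\<lambda>\<omega>. 0)"
      using ae by (intro integral_cong_AE) auto
    ultimately show ?thesis using True k by simp
  next
    case False
    with \<rho> have pos: "0 < \<rho>" by simp
    have "distr M lborel Z = distr M borel Z" by (intro distr_cong) auto
    then have "distributed M lborel Z (normal_density 0 \<rho>)"
      using law False by (auto simp: distributed_def normal_law_def)
    from centered_normal_moment[OF this pos] show ?thesis by blast
  qed
  then show "integrable M (\<lambda>\<omega>. (Z \<omega>) ^ (2 * k))"
    and "expectation (\<lambda>\<omega>. (Z \<omega>) ^ (2 * k)) = (\<rho>\<^sup>2) ^ k * (fact (2 * k) / (2 ^ k * fact k))" by auto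
qed

section \<open>Scores in the Gaussian linear model\<close>

context linear_model
begin

lemma observation_measurable:
  "i < n \<Longrightarrow> (\<lambda>\<omega>. (covariates p X i \<omega>, Y i \<omega>)) \<in> measurable M (vec_space p \<Otimes>\<^sub>M borel)"
  using indep by (auto simp: indep_vars_def)

lemma covariates_measurable[measurable]: "i < n \<Longrightarrow> covariates p X i \<in> measurable M (vec_space p)"
  using measurable_compose[OF observation_measurable measurable_fst] by simp

lemma Y_measurable[measurable]: "i < n \<Longrightarrow> Y i \<in> borel_measurable M"
  using measurable_compose[OF observation_measurable measurable_snd] by simp

lemma X_measurable[measurable]:
  assumes "i < n" "j < p"
  shows "X i j \<in> borel_measurable M"
proof -
  have "(\<lambda>x. x j) \<in> borel_measurable (vec_space p)"
    by (rule measurable_component_singleton) (use assms in auto)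
  from measurable_compose[OF covariates_measurable[OF assms(1)] this]
  show ?thesis using assms by (simp add: covariates_def)
qed

lemma naive_estimator_measurable: "naive_estimator n p X Y \<in> borel_measurable M"
proof -
  have "(\<lambda>\<omega>. (\<Sum>b<n. \<Sum>a<b. \<Sum>j<p. (X a j \<omega> * Y a \<omega>) * (X b j \<omega> * Y b \<omega>)) / real (n choose 2)) \<in> borel_measurable M"
    by (intro borel_measurable_divide borel_measurable_sum borel_measurable_times borel_measurable_const
        X_measurable Y_measurable) auto
  then show ?thesis by (simp add: naive_estimator_def[abs_def] Let_def)
qed

end

text \<open>The case \<open>\<sigma> = 0\<close>, \<open>\<beta> = 0\<close> is excluded: there the responses vanish almost surely and \<open>\<psi>\<close> is 0, so
  that the estimator cannot be standardised.\<close>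

locale gaussian_linear_model = linear_model +
  assumes X_normal: "\<And>i. i < n \<Longrightarrow> distr M (vec_space p) (covariates p X i) = std_normal_vec p"
    and error_normal: "\<And>i. i < n \<Longrightarrow> distr M borel (\<epsilon> i) = normal_law \<sigma>"
    and p_ge: "1 \<le> p"
    and noise_or_signal: "0 < \<sigma>\<^sup>2 + dot p \<beta> \<beta>"
begin

definition proj :: "nat \<Rightarrow> (nat \<Rightarrow> real) \<Rightarrow> 'a \<Rightarrow> real" where
  "proj i x \<omega> = dot p x (\<lambda>j. X i j \<omega>)"

lemma proj_measurable[measurable]: "i < n \<Longrightarrow> proj i x \<in> borel_measurable M"
  unfolding proj_def[abs_def] by (intro borel_measurable_dot) auto

lemma Y_eq: "i < n \<Longrightarrow> \<omega> \<in> space M \<Longrightarrow> Y i \<omega> = proj i \<beta> \<omega> + \<epsilon> i \<omega>"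
  by (simp add: model proj_def dot_def)

lemma error_measurable[measurable]:
  assumes "i < n"
  shows "\<epsilon> i \<in> borel_measurable M"
proof -
  have "(\<lambda>\<omega>. Y i \<omega> - proj i \<beta> \<omega>) \<in> borel_measurable M" using assms by measurable
  then show ?thesis by (rule measurable_cong[THEN iffD1, rotated]) (use assms in \<open>simp add: Y_eq\<close>)
qed

lemma X_std_normal:
  assumes "i < n" "j < p"
  shows "distr M borel (X i j) = std_normal_distribution"
proof -
  have c: "(\<lambda>x. x j) \<in> borel_measurable (vec_space p)"
    by (rule measurable_component_singleton) (use assms in auto)
  have "distr M borel (X i j) = distr (distr M (vec_space p) (covariates p X i)) borel (\<lambda>x. x j)"
    by (subst distr_distr) (use assms c in \<open>auto simp: comp_def covariates_def\<close>)
  also have "\<dots> = distr (PiM {..<p} (\<lambda>_. std_normal_distribution)) std_normal_distribution (\<lambda>x. x j)"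
    unfolding X_normal[OF assms(1)] std_normal_vec_def by (intro distr_cong) auto
  also have "\<dots> = std_normal_distribution"
    by (rule distr_PiM_component) (use assms prob_space_normal_density in auto)
  finally show ?thesis .
qed

lemma X_coords_indep:
  assumes "i < n"
  shows "indep_vars (\<lambda>_. borel) (X i) {..<p}"
proof (subst indep_vars_iff_distr_eq_PiM')
  show "{..<p} \<noteq> {}" using p_ge by (simp add: lessThan_empty_iff)
  show "random_variable borel (X i j)" if "j \<in> {..<p}" for j using that assms by auto
  have "distr M (PiM {..<p} (\<lambda>_. borel)) (\<lambda>\<omega>. \<lambda>j\<in>{..<p}. X i j \<omega>) = PiM {..<p} (\<lambda>_. std_normal_distribution)"
    using X_normal[OF assms] by (simp add: covariates_def[abs_def] std_normal_vec_def)
  also have "\<dots> = PiM {..<p} (\<lambda>j. distr M borel (X i j))"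
    using assms by (intro PiM_cong refl X_std_normal[symmetric]) auto
  finally show "distr M (PiM {..<p} (\<lambda>_. borel)) (\<lambda>\<omega>. \<lambda>j\<in>{..<p}. X i j \<omega>) = PiM {..<p} (\<lambda>j. distr M borel (X i j))" .
qed

text \<open>A linear combination of independent standard normal variables. Coordinates with coefficient 0 are removed
  first, since the rule for sums of normal variables asks for positive variances.\<close>

lemma proj_normal:
  assumes i: "i < n" and x: "0 < dot p x x"
  shows "distributed M lborel (proj i x) (normal_density 0 (sqrt (dot p x x)))"
proof -
  define J where "J = {j. j < p \<and> x j \<noteq> 0}"
  have J: "finite J" "J \<subseteq> {..<p}" by (auto simp: J_def)
  have dJ: "dot p x z = (\<Sum>j\<in>J. x j * z j)" for z
    unfolding dot_def J_def by (rule sum.mono_neutral_right) auto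
  have ne: "J \<noteq> {}" using x by (auto simp: dJ)
  have ind: "indep_vars (\<lambda>_. borel) (\<lambda>j \<omega>. x j * X i j \<omega>) J"
    by (rule indep_vars_compose2[OF indep_vars_subset[OF X_coords_indep[OF i] J(2)]]) auto
  have normal: "distributed M lborel (\<lambda>\<omega>. x j * X i j \<omega>) (normal_density 0 \<bar>x j\<bar>)" if j: "j \<in> J" for j
  proof -
    have jp: "j < p" "x j \<noteq> 0" using j by (auto simp: J_def)
    have "distr M lborel (X i j) = distr M borel (X i j)" by (intro distr_cong) auto
    then have "distributed M lborel (X i j) std_normal_density"
      using X_std_normal[OF i jp(1)] i jp by (auto simp: distributed_def)
    from normal_density_affine[OF this, of "x j" 0] jp show ?thesis by simp
  qed
  have "distributed M lborel (\<lambda>\<omega>. \<Sum>j\<in>J. x j * X i j \<omega>) (normal_density (\<Sum>j\<in>J. 0) (sqrt (\<Sum>j\<in>J. \<bar>x j\<bar>\<^sup>2)))"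
    by (rule sum_indep_normal[OF J(1) ne ind]) (use normal in \<open>auto simp: J_def\<close>)
  then show ?thesis by (simp add: proj_def[abs_def] dJ power2_eq_square)
qed

lemma proj_moment:
  assumes i: "i < n" and k: "0 < k"
  shows "integrable M (\<lambda>\<omega>. (proj i x \<omega>) ^ (2 * k))"
    and "expectation (\<lambda>\<omega>. (proj i x \<omega>) ^ (2 * k)) = (dot p x x) ^ k * (fact (2 * k) / (2 ^ k * fact k))"
proof -
  have "integrable M (\<lambda>\<omega>. (proj i x \<omega>) ^ (2 * k)) \<and>
    expectation (\<lambda>\<omega>. (proj i x \<omega>) ^ (2 * k)) = (dot p x x) ^ k * (fact (2 * k) / (2 ^ k * fact k))"
  proof (cases "0 < dot p x x")
    case True
    then show ?thesis using centered_normal_moment[OF proj_normal[OF i True], of k] by simp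
  next
    case False
    then have z: "dot p x x = 0" using dot_self_nonneg[of p x] by simp
    then have "proj i x \<omega> = 0" for \<omega>
      using dot_Cauchy_Schwarz[of p x "\<lambda>j. X i j \<omega>"] by (simp add: proj_def)
    then show ?thesis using z k by (simp add: zero_power)
  qed
  then show "integrable M (\<lambda>\<omega>. (proj i x \<omega>) ^ (2 * k))"
    and "expectation (\<lambda>\<omega>. (proj i x \<omega>) ^ (2 * k)) = (dot p x x) ^ k * (fact (2 * k) / (2 ^ k * fact k))" by auto
qed

lemma proj_add: "proj i (\<lambda>j. x j + y j) \<omega> = proj i x \<omega> + proj i y \<omega>"
  by (simp add: proj_def dot_add_left)

lemma proj_diff: "proj i (\<lambda>j. x j - y j) \<omega> = proj i x \<omega> - proj i y \<omega>"
  by (simp add: proj_def dot_def left_diff_distrib sum_subtractf)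

lemma proj_L4: "i < n \<Longrightarrow> L4 M (proj i x)"
  using proj_moment(1)[of i 2 x] by (simp add: L4_def)

lemma proj_sq_L4: "i < n \<Longrightarrow> L4 M (\<lambda>\<omega>. (proj i x \<omega>)\<^sup>2)"
  using proj_moment(1)[of i 4 x] by (simp add: L4_def power_mult[symmetric])

lemma error_L4: "i < n \<Longrightarrow> L4 M (\<epsilon> i)"
  using normal_law_moment(1)[OF _ error_normal sigma_nonneg, of i 2] by (simp add: L4_def)

lemma error_sq_L4: "i < n \<Longrightarrow> L4 M (\<lambda>\<omega>. (\<epsilon> i \<omega>)\<^sup>2)"
  using normal_law_moment(1)[OF _ error_normal sigma_nonneg, of i 4] by (simp add: L4_def power_mult[symmetric])

text \<open>Products of degree two keep fourth-power integrability because normal variables have eighth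
  moments; this is expressed by the squares being in \<^const>\<open>L4\<close>.\<close>

lemma L4_times:
  assumes "f \<in> borel_measurable M" "g \<in> borel_measurable M"
    and "L4 M (\<lambda>\<omega>. (f \<omega>)\<^sup>2)" "L4 M (\<lambda>\<omega>. (g \<omega>)\<^sup>2)"
  shows "L4 M (\<lambda>\<omega>. f \<omega> * g \<omega>)"
  using L4_mult[OF assms(3,4)] assms(1,2) by (simp add: L2_def L4_def power_mult_distrib power_mult[symmetric])

lemma proj_second: "i < n \<Longrightarrow> expectation (\<lambda>\<omega>. (proj i x \<omega>)\<^sup>2) = dot p x x"
  using proj_moment(2)[of i 1 x] by (simp add: fact_numeral)

lemma proj_fourth: "i < n \<Longrightarrow> expectation (\<lambda>\<omega>. (proj i x \<omega>) ^ 4) = 3 * (dot p x x)\<^sup>2"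
  using proj_moment(2)[of i 2 x] by (simp add: fact_numeral)

lemma proj_eighth: "i < n \<Longrightarrow> expectation (\<lambda>\<omega>. (proj i x \<omega>) ^ 8) = 105 * (dot p x x) ^ 4"
  using proj_moment(2)[of i 4 x] by (simp add: fact_numeral)

lemma error_eighth: "i < n \<Longrightarrow> expectation (\<lambda>\<omega>. (\<epsilon> i \<omega>) ^ 8) = 105 * (\<sigma>\<^sup>2) ^ 4"
  using normal_law_moment(2)[OF _ error_normal sigma_nonneg, of i 4] by (simp add: fact_numeral)

lemma dot_sum_self: "dot p (\<lambda>j. x j + y j) (\<lambda>j. x j + y j) = dot p x x + 2 * dot p x y + dot p y y"
  by (simp add: dot_add_left dot_add_right dot_commute[of p y x])

lemma dot_diff_self: "dot p (\<lambda>j. x j - y j) (\<lambda>j. x j - y j) = dot p x x - 2 * dot p x y + dot p y y"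
  by (simp add: dot_def algebra_simps sum.distrib sum_subtractf sum_distrib_left)

lemma proj_product_mean:
  assumes i: "i < n"
  shows "expectation (\<lambda>\<omega>. proj i x \<omega> * proj i y \<omega>) = dot p x y"
proof -
  have int: "integrable M (\<lambda>\<omega>. (proj i z \<omega>)\<^sup>2)" for z by (intro L2_D(2) L4_imp_L2 proj_L4 i)
  have "expectation (\<lambda>\<omega>. proj i x \<omega> * proj i y \<omega>) =
      expectation (\<lambda>\<omega>. ((proj i (\<lambda>j. x j + y j) \<omega>)\<^sup>2 - (proj i x \<omega>)\<^sup>2 - (proj i y \<omega>)\<^sup>2) / 2)"
    by (intro Bochner_Integration.integral_cong refl) (simp add: proj_add power2_sum)
  also have "\<dots> = dot p x y"
    using int by (simp add: proj_second[OF i] dot_sum_self)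
  finally show ?thesis .
qed

text \<open>Polarisation: \<open>12 x\<^sup>2 y\<^sup>2 = (x + y)\<^sup>4 + (x - y)\<^sup>4 - 2 x\<^sup>4 - 2 y\<^sup>4\<close> reduces the mixed moment to fourth
  moments of single projections.\<close>

lemma proj_square_product_mean:
  assumes i: "i < n"
  shows "expectation (\<lambda>\<omega>. (proj i x \<omega>)\<^sup>2 * (proj i y \<omega>)\<^sup>2) = dot p x x * dot p y y + 2 * (dot p x y)\<^sup>2"
proof -
  have int: "integrable M (\<lambda>\<omega>. (proj i z \<omega>) ^ 4)" for z by (intro L4_D(2) proj_L4 i)
  have "expectation (\<lambda>\<omega>. (proj i x \<omega>)\<^sup>2 * (proj i y \<omega>)\<^sup>2) =
      expectation (\<lambda>\<omega>. ((proj i (\<lambda>j. x j + y j) \<omega>) ^ 4 + (proj i (\<lambda>j. x j - y j) \<omega>) ^ 4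
        - 2 * (proj i x \<omega>) ^ 4 - 2 * (proj i y \<omega>) ^ 4) / 12)"
    by (intro Bochner_Integration.integral_cong refl)
      (simp add: proj_add proj_diff power2_eq_square power4_eq_xxxx algebra_simps)
  also have "\<dots> = (3 * (dot p x x + 2 * dot p x y + dot p y y)\<^sup>2 + 3 * (dot p x x - 2 * dot p x y + dot p y y)\<^sup>2
      - 2 * (3 * (dot p x x)\<^sup>2) - 2 * (3 * (dot p y y)\<^sup>2)) / 12"
    using int by (simp add: proj_fourth[OF i] dot_sum_self dot_diff_self)
  also have "\<dots> = dot p x x * dot p y y + 2 * (dot p x y)\<^sup>2"
    by (simp add: power2_eq_square algebra_simps)
  finally show ?thesis .
qed

abbreviation covariate_algebra :: "nat \<Rightarrow> 'a measure" where
  "covariate_algebra i \<equiv> vimage_algebra (space M) (covariates p X i) (vec_space p)"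

lemma covariate_subalgebra:
  assumes "i < n"
  shows "finite_measure_subalgebra M (covariate_algebra i)"
proof
  show "subalgebra M (covariate_algebra i)"
    unfolding subalgebra_def using covariates_measurable[OF assms] by (simp add: measurable_iff_sets)
qed

lemma proj_covariate_measurable:
  assumes "i < n"
  shows "proj i x \<in> borel_measurable (covariate_algebra i)"
proof -
  have "(\<lambda>z. dot p x z) \<in> borel_measurable (vec_space p)"
    by (rule borel_measurable_dot) (auto intro: measurable_component_singleton)
  moreover have "covariates p X i \<in> measurable (covariate_algebra i) (vec_space p)"
    by (rule measurable_vimage_algebra1) (use assms in \<open>auto dest: measurable_space[OF covariates_measurable]\<close>)
  moreover have "dot p x (covariates p X i \<omega>) = proj i x \<omega>" for \<omega>
    unfolding proj_def dot_def covariates_def by (intro sum.cong) auto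
  ultimately show ?thesis
    using measurable_compose[of "covariates p X i" "covariate_algebra i" "vec_space p" "\<lambda>z. dot p x z" borel] by simp
qed

text \<open>Tested against functions of the covariates, the two conditional moment conditions on the errors become
  statements about plain expectations.\<close>

lemma error_uncorrelated:
  assumes i: "i < n" and f: "f \<in> borel_measurable (covariate_algebra i)"
    and int: "integrable M (\<lambda>\<omega>. f \<omega> * \<epsilon> i \<omega>)"
  shows "expectation (\<lambda>\<omega>. f \<omega> * \<epsilon> i \<omega>) = 0"
proof -
  interpret F: finite_measure_subalgebra M "covariate_algebra i" by (rule covariate_subalgebra[OF i])
  have [measurable]: "\<epsilon> i \<in> borel_measurable M" using i by simp
  have [measurable]: "f \<in> borel_measurable M" by (rule measurable_from_subalg[OF F.subalg f])
  have "expectation (\<lambda>\<omega>. f \<omega> * \<epsilon> i \<omega>) = expectation (\<lambda>\<omega>. f \<omega> * real_cond_exp M (covariate_algebra i) (\<epsilon> i) \<omega>)"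
    using F.real_cond_exp_intg(2)[OF int f] by simp
  also have "\<dots> = expectation (\<lambda>\<omega>. 0)"
    using error_mean[OF i] by (intro integral_cong_AE) auto
  finally show ?thesis by simp
qed

lemma error_square_uncorrelated:
  assumes i: "i < n" and f: "f \<in> borel_measurable (covariate_algebra i)"
    and int: "integrable M (\<lambda>\<omega>. f \<omega> * (\<epsilon> i \<omega>)\<^sup>2)"
  shows "expectation (\<lambda>\<omega>. f \<omega> * (\<epsilon> i \<omega>)\<^sup>2) = \<sigma>\<^sup>2 * expectation f"
proof -
  interpret F: finite_measure_subalgebra M "covariate_algebra i" by (rule covariate_subalgebra[OF i])
  have [measurable]: "\<epsilon> i \<in> borel_measurable M" using i by simp
  have [measurable]: "f \<in> borel_measurable M" by (rule measurable_from_subalg[OF F.subalg f])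
  have "expectation (\<lambda>\<omega>. f \<omega> * (\<epsilon> i \<omega>)\<^sup>2) =
      expectation (\<lambda>\<omega>. f \<omega> * real_cond_exp M (covariate_algebra i) (\<lambda>\<omega>. (\<epsilon> i \<omega>)\<^sup>2) \<omega>)"
    using F.real_cond_exp_intg(2)[OF int f] by simp
  also have "\<dots> = expectation (\<lambda>\<omega>. f \<omega> * \<sigma>\<^sup>2)"
    using error_variance[OF i] by (intro integral_cong_AE) auto
  finally show ?thesis by simp
qed

text \<open>The values from \<open>p\<close> on are set to \<^const>\<open>undefined\<close>, as \<^term>\<open>vec_space p\<close> requires of its elements.\<close>

definition score :: "nat \<Rightarrow> 'a \<Rightarrow> nat \<Rightarrow> real" where
  "score i \<omega> = (\<lambda>j\<in>{..<p}. X i j \<omega> * Y i \<omega> - \<beta> j)"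

lemma dot_score:
  assumes "i < n" "\<omega> \<in> space M"
  shows "dot p x (score i \<omega>) = proj i x \<omega> * (proj i \<beta> \<omega> + \<epsilon> i \<omega>) - dot p x \<beta>"
  unfolding Y_eq[OF assms, symmetric]
  by (simp add: score_def proj_def dot_def right_diff_distrib sum_subtractf sum_distrib_left mult_ac)

lemma score_indep: "indep_vars (\<lambda>_. vec_space p) score {..<n}"
proof -
  have "(\<lambda>z. \<lambda>j\<in>{..<p}. fst z j * snd z - \<beta> j) \<in> measurable (vec_space p \<Otimes>\<^sub>M borel) (vec_space p)"
  proof (rule measurable_restrict)
    fix j assume "j \<in> {..<p}"
    then have "(\<lambda>x. x j) \<in> borel_measurable (vec_space p)" by (rule measurable_component_singleton)
    from measurable_compose[OF measurable_fst this]
    show "(\<lambda>z. fst z j * snd z - \<beta> j) \<in> borel_measurable (vec_space p \<Otimes>\<^sub>M borel)"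
      by (intro borel_measurable_diff borel_measurable_times) auto
  qed
  from indep_vars_compose2[OF indep, of "\<lambda>_ z. \<lambda>j\<in>{..<p}. fst z j * snd z - \<beta> j" "\<lambda>_. vec_space p", OF this]
  show ?thesis
    by (rule indep_vars_cong[THEN iffD1, rotated -1]) (auto simp: score_def covariates_def fun_eq_iff)
qed

lemma response_sq_L4:
  assumes i: "i < n"
  shows "L4 M (\<lambda>\<omega>. (proj i \<beta> \<omega> + \<epsilon> i \<omega>)\<^sup>2)"
proof -
  have "L4 M (\<lambda>\<omega>. (proj i \<beta> \<omega>)\<^sup>2 + 2 * (proj i \<beta> \<omega> * \<epsilon> i \<omega>) + (\<epsilon> i \<omega>)\<^sup>2)"
    by (intro L4_add L4_cmult L4_times proj_measurable error_measurable proj_sq_L4 error_sq_L4 i)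
  then show ?thesis by (simp add: power2_sum algebra_simps)
qed

lemma response_L4:
  assumes i: "i < n"
  shows "L4 M (\<lambda>\<omega>. proj i x \<omega> * (proj i \<beta> \<omega> + \<epsilon> i \<omega>))"
  by (intro L4_times response_sq_L4 proj_sq_L4 proj_measurable borel_measurable_add error_measurable i)

lemma score_dot_L4:
  assumes i: "i < n"
  shows "L4 M (\<lambda>\<omega>. dot p x (score i \<omega>))"
proof -
  have "L4 M (\<lambda>\<omega>. proj i x \<omega> * (proj i \<beta> \<omega> + \<epsilon> i \<omega>) + (- dot p x \<beta>))"
    by (intro L4_add L4_const response_L4 i)
  then show ?thesis unfolding L4_def
    using measurable_cong[of M "\<lambda>\<omega>. dot p x (score i \<omega>)" "\<lambda>\<omega>. proj i x \<omega> * (proj i \<beta> \<omega> + \<epsilon> i \<omega>) - dot p x \<beta>" borel]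
    by (auto simp: dot_score[OF i] cong: Bochner_Integration.integrable_cong)
qed

lemma score_L4: "i < n \<Longrightarrow> j < p \<Longrightarrow> L4 M (\<lambda>\<omega>. score i \<omega> j)"
  using score_dot_L4[of i "\<lambda>k. if k = j then 1 else 0"] by (simp add: dot_unit)

lemma response_mean:
  assumes i: "i < n"
  shows "expectation (\<lambda>\<omega>. proj i x \<omega> * (proj i \<beta> \<omega> + \<epsilon> i \<omega>)) = dot p x \<beta>"
proof -
  have i1: "integrable M (\<lambda>\<omega>. proj i x \<omega> * proj i \<beta> \<omega>)" and i2: "integrable M (\<lambda>\<omega>. proj i x \<omega> * \<epsilon> i \<omega>)"
    by (intro L2_integrable L4_mult proj_L4 error_L4 i)+
  have "expectation (\<lambda>\<omega>. proj i x \<omega> * (proj i \<beta> \<omega> + \<epsilon> i \<omega>))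
      = expectation (\<lambda>\<omega>. proj i x \<omega> * proj i \<beta> \<omega>) + expectation (\<lambda>\<omega>. proj i x \<omega> * \<epsilon> i \<omega>)"
    using i1 i2 by (simp add: distrib_left)
  also have "expectation (\<lambda>\<omega>. proj i x \<omega> * \<epsilon> i \<omega>) = 0"
    by (rule error_uncorrelated[OF i proj_covariate_measurable[OF i] i2])
  finally show ?thesis by (simp add: proj_product_mean[OF i])
qed

text \<open>Writing the response as \<open>\<beta>\<^sup>T X + \<epsilon>\<close>, the mixed term vanishes because \<open>\<epsilon>\<close> is conditionally
  centred, the noise contributes \<open>\<sigma>\<^sup>2 x\<^sup>T x\<close> and the signal a mixed fourth moment of normal variables.\<close>

lemma response_second:
  assumes i: "i < n"
  shows "expectation (\<lambda>\<omega>. (proj i x \<omega> * (proj i \<beta> \<omega> + \<epsilon> i \<omega>))\<^sup>2)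
    = (\<sigma>\<^sup>2 + dot p \<beta> \<beta>) * dot p x x + 2 * (dot p x \<beta>)\<^sup>2"
proof -
  have m: "proj i z \<in> borel_measurable (covariate_algebra i)" for z by (rule proj_covariate_measurable[OF i])
  have i1: "integrable M (\<lambda>\<omega>. (proj i x \<omega>)\<^sup>2 * (proj i \<beta> \<omega>)\<^sup>2)"
    by (intro L2_integrable L4_mult proj_sq_L4 i)
  have "integrable M (\<lambda>\<omega>. (proj i x \<omega> * proj i \<beta> \<omega>) * (proj i x \<omega> * \<epsilon> i \<omega>))"
    by (intro L2_mult_integrable L4_mult proj_L4 error_L4 i)
  then have i2: "integrable M (\<lambda>\<omega>. ((proj i x \<omega>)\<^sup>2 * proj i \<beta> \<omega>) * \<epsilon> i \<omega>)"
    by (simp add: power2_eq_square mult_ac)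
  have i3: "integrable M (\<lambda>\<omega>. (proj i x \<omega>)\<^sup>2 * (\<epsilon> i \<omega>)\<^sup>2)"
    by (intro L2_integrable L4_mult proj_sq_L4 error_sq_L4 i)
  have "expectation (\<lambda>\<omega>. (proj i x \<omega> * (proj i \<beta> \<omega> + \<epsilon> i \<omega>))\<^sup>2) = expectation (\<lambda>\<omega>.
      (proj i x \<omega>)\<^sup>2 * (proj i \<beta> \<omega>)\<^sup>2 + 2 * (((proj i x \<omega>)\<^sup>2 * proj i \<beta> \<omega>) * \<epsilon> i \<omega>) + (proj i x \<omega>)\<^sup>2 * (\<epsilon> i \<omega>)\<^sup>2)"
    by (intro Bochner_Integration.integral_cong refl) (simp add: power2_eq_square algebra_simps)
  also have "\<dots> = expectation (\<lambda>\<omega>. (proj i x \<omega>)\<^sup>2 * (proj i \<beta> \<omega>)\<^sup>2)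
      + 2 * expectation (\<lambda>\<omega>. ((proj i x \<omega>)\<^sup>2 * proj i \<beta> \<omega>) * \<epsilon> i \<omega>) + expectation (\<lambda>\<omega>. (proj i x \<omega>)\<^sup>2 * (\<epsilon> i \<omega>)\<^sup>2)"
    using i1 i2 i3 by simp
  also have "expectation (\<lambda>\<omega>. ((proj i x \<omega>)\<^sup>2 * proj i \<beta> \<omega>) * \<epsilon> i \<omega>) = 0"
    by (rule error_uncorrelated[OF i _ i2]) (intro borel_measurable_times borel_measurable_power m)
  also have "expectation (\<lambda>\<omega>. (proj i x \<omega>)\<^sup>2 * (\<epsilon> i \<omega>)\<^sup>2) = \<sigma>\<^sup>2 * expectation (\<lambda>\<omega>. (proj i x \<omega>)\<^sup>2)"
    by (rule error_square_uncorrelated[OF i _ i3]) (intro borel_measurable_power m)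
  finally show ?thesis
    by (simp add: proj_square_product_mean[OF i] proj_second[OF i] dot_commute[of p \<beta> x] algebra_simps)
qed

lemma score_mean:
  assumes i: "i < n"
  shows "expectation (\<lambda>\<omega>. dot p x (score i \<omega>)) = 0"
proof -
  have "expectation (\<lambda>\<omega>. dot p x (score i \<omega>)) = expectation (\<lambda>\<omega>. proj i x \<omega> * (proj i \<beta> \<omega> + \<epsilon> i \<omega>) - dot p x \<beta>)"
    by (intro Bochner_Integration.integral_cong refl dot_score i)
  then show ?thesis
    using L2_integrable[OF L4_imp_L2[OF response_L4[OF i, of x]]] by (simp add: response_mean[OF i] prob_space)
qed

lemma score_second:
  assumes i: "i < n"
  shows "expectation (\<lambda>\<omega>. (dot p x (score i \<omega>))\<^sup>2) = (\<sigma>\<^sup>2 + dot p \<beta> \<beta>) * dot p x x + (dot p x \<beta>)\<^sup>2"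
proof -
  let ?z = "\<lambda>\<omega>. proj i x \<omega> * (proj i \<beta> \<omega> + \<epsilon> i \<omega>)"
  note L2 = L4_imp_L2[OF response_L4[OF i, of x]]
  have "expectation (\<lambda>\<omega>. (dot p x (score i \<omega>))\<^sup>2) = expectation (\<lambda>\<omega>. (?z \<omega> - expectation ?z)\<^sup>2)"
    by (intro Bochner_Integration.integral_cong refl) (simp add: dot_score[OF i] response_mean[OF i])
  also have "\<dots> = expectation (\<lambda>\<omega>. (?z \<omega>)\<^sup>2) - (expectation ?z)\<^sup>2"
    by (rule variance_eq[OF L2_integrable[OF L2] L2_D(2)[OF L2]])
  finally show ?thesis by (simp add: response_second[OF i] response_mean[OF i])
qed

lemma response_eighth:
  assumes i: "i < n"
  shows "integrable M (\<lambda>\<omega>. (proj i \<beta> \<omega> + \<epsilon> i \<omega>) ^ 8)"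
    and "expectation (\<lambda>\<omega>. (proj i \<beta> \<omega> + \<epsilon> i \<omega>) ^ 8) \<le> 13440 * (\<sigma>\<^sup>2 + dot p \<beta> \<beta>) ^ 4"
proof -
  show int: "integrable M (\<lambda>\<omega>. (proj i \<beta> \<omega> + \<epsilon> i \<omega>) ^ 8)"
    using L4_D(2)[OF response_sq_L4[OF i]] by (simp add: power_mult[symmetric])
  have ip: "integrable M (\<lambda>\<omega>. (proj i \<beta> \<omega>) ^ 8)" and ie: "integrable M (\<lambda>\<omega>. (\<epsilon> i \<omega>) ^ 8)"
    using L4_D(2)[OF proj_sq_L4[OF i]] L4_D(2)[OF error_sq_L4[OF i]] by (simp_all add: power_mult[symmetric])
  have "expectation (\<lambda>\<omega>. (proj i \<beta> \<omega> + \<epsilon> i \<omega>) ^ 8) \<le> expectation (\<lambda>\<omega>. 128 * (proj i \<beta> \<omega>) ^ 8 + 128 * (\<epsilon> i \<omega>) ^ 8)"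
  proof (rule integral_mono[OF int])
    show "integrable M (\<lambda>\<omega>. 128 * (proj i \<beta> \<omega>) ^ 8 + 128 * (\<epsilon> i \<omega>) ^ 8)" using ip ie by simp
    show "(proj i \<beta> \<omega> + \<epsilon> i \<omega>) ^ 8 \<le> 128 * (proj i \<beta> \<omega>) ^ 8 + 128 * (\<epsilon> i \<omega>) ^ 8" for \<omega>
    proof -
      have sq: "z ^ 8 = (z ^ 4)\<^sup>2" for z :: real by (simp add: power_mult[symmetric])
      have "(proj i \<beta> \<omega> + \<epsilon> i \<omega>) ^ 8 \<le> (8 * (proj i \<beta> \<omega>) ^ 4 + 8 * (\<epsilon> i \<omega>) ^ 4)\<^sup>2"
        unfolding sq by (intro power_mono power4_add_le) auto
      also have "\<dots> \<le> 2 * (8 * (proj i \<beta> \<omega>) ^ 4)\<^sup>2 + 2 * (8 * (\<epsilon> i \<omega>) ^ 4)\<^sup>2" by (rule power2_add_le)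
      finally show ?thesis unfolding sq[of "proj i \<beta> \<omega>"] sq[of "\<epsilon> i \<omega>"] by (simp add: power_mult_distrib)
    qed
  qed
  also have "\<dots> = 13440 * ((dot p \<beta> \<beta>) ^ 4 + (\<sigma>\<^sup>2) ^ 4)"
    using ip ie by (simp add: proj_eighth[OF i] error_eighth[OF i])
  also have "(dot p \<beta> \<beta>) ^ 4 + (\<sigma>\<^sup>2) ^ 4 \<le> (\<sigma>\<^sup>2 + dot p \<beta> \<beta>) ^ 4"
  proof -
    have a: "0 \<le> dot p \<beta> \<beta>" by (rule dot_self_nonneg)
    have *: "x\<^sup>2 + y\<^sup>2 \<le> (x + y)\<^sup>2" if "0 \<le> x" "0 \<le> y" for x y :: real using that by (simp add: power2_sum)
    have sq: "z ^ 4 = (z\<^sup>2)\<^sup>2" for z :: real by simp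
    have "((dot p \<beta> \<beta>)\<^sup>2)\<^sup>2 + ((\<sigma>\<^sup>2)\<^sup>2)\<^sup>2 \<le> ((dot p \<beta> \<beta>)\<^sup>2 + (\<sigma>\<^sup>2)\<^sup>2)\<^sup>2" by (intro *) auto
    also have "\<dots> \<le> ((dot p \<beta> \<beta> + \<sigma>\<^sup>2)\<^sup>2)\<^sup>2" using a by (intro power_mono *) auto
    finally show ?thesis unfolding sq by (simp add: add.commute)
  qed
  finally show "expectation (\<lambda>\<omega>. (proj i \<beta> \<omega> + \<epsilon> i \<omega>) ^ 8) \<le> 13440 * (\<sigma>\<^sup>2 + dot p \<beta> \<beta>) ^ 4" by simp
qed

text \<open>The error may depend on the covariates, so \<open>(x\<^sup>T X)\<^sup>4 Y\<^sup>4\<close> is separated by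
  \<open>2 a b \<le> c a\<^sup>2 + b\<^sup>2 / c\<close> into eighth powers of the two factors. The weights \<open>s / x\<^sup>T x\<close> and its inverse
  balance the two terms, which gives the required homogeneity in \<open>s\<close> and \<open>x\<close>.\<close>

lemma score_fourth:
  assumes i: "i < n"
  shows "expectation (\<lambda>\<omega>. (dot p x (score i \<omega>)) ^ 4) \<le> 55000 * (\<sigma>\<^sup>2 + dot p \<beta> \<beta>)\<^sup>2 * (dot p x x)\<^sup>2"
proof (cases "dot p x x = 0")
  case True
  have "dot p x z = 0" for z using dot_Cauchy_Schwarz[of p x z] True by simp
  then show ?thesis using True by simp
next
  case False
  let ?s = "\<sigma>\<^sup>2 + dot p \<beta> \<beta>" and ?q = "dot p x x"
  have q: "0 < ?q" using False dot_self_nonneg[of p x] by simp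
  have s: "0 < ?s" by (rule noise_or_signal)
  have ip: "integrable M (\<lambda>\<omega>. (proj i x \<omega>) ^ 8)"
    using L4_D(2)[OF proj_sq_L4[OF i]] by (simp add: power_mult[symmetric])
  note iy = response_eighth(1)[OF i]
  have i4: "integrable M (\<lambda>\<omega>. (dot p x (score i \<omega>)) ^ 4)" by (rule L4_D(2)[OF score_dot_L4[OF i]])
  let ?b = "\<lambda>\<omega>. 4 * (?s / ?q)\<^sup>2 * (proj i x \<omega>) ^ 8 + 4 * (?q / ?s)\<^sup>2 * (proj i \<beta> \<omega> + \<epsilon> i \<omega>) ^ 8 + 8 * (?q * ?s)\<^sup>2"
  have "expectation (\<lambda>\<omega>. (dot p x (score i \<omega>)) ^ 4) \<le> expectation ?b"
  proof (rule integral_mono[OF i4])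
    show "integrable M ?b" using ip iy by simp
    fix \<omega> assume \<omega>: "\<omega> \<in> space M"
    let ?a = "proj i x \<omega>" and ?y = "proj i \<beta> \<omega> + \<epsilon> i \<omega>"
    have sq: "z ^ 8 = (z ^ 4)\<^sup>2" for z :: real by (simp add: power_mult[symmetric])
    have "(dot p x \<beta>)\<^sup>2 \<le> ?q * ?s"
    proof -
      have "(dot p x \<beta>)\<^sup>2 \<le> ?q * dot p \<beta> \<beta>" by (rule dot_Cauchy_Schwarz)
      also have "\<dots> \<le> ?q * ?s" using q by (intro mult_left_mono) auto
      finally show ?thesis .
    qed
    then have "((dot p x \<beta>)\<^sup>2)\<^sup>2 \<le> (?q * ?s)\<^sup>2" by (intro power_mono) auto
    then have c: "(- dot p x \<beta>) ^ 4 \<le> (?q * ?s)\<^sup>2" by simp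
    have "2 * (?a ^ 4 * ?y ^ 4) \<le> (?s / ?q)\<^sup>2 * ?a ^ 8 + (?q / ?s)\<^sup>2 * ?y ^ 8"
    proof -
      have "0 \<le> ((?s / ?q) * ?a ^ 4 - (?q / ?s) * ?y ^ 4)\<^sup>2" by simp
      also have "\<dots> = (?s / ?q)\<^sup>2 * ?a ^ 8 + (?q / ?s)\<^sup>2 * ?y ^ 8 - 2 * ((?s / ?q) * (?q / ?s)) * (?a ^ 4 * ?y ^ 4)"
        unfolding sq by (simp only: power2_diff power_mult_distrib) (simp add: mult_ac)
      also have "(?s / ?q) * (?q / ?s) = 1" using q s by simp
      finally show ?thesis by simp
    qed
    moreover have "(dot p x (score i \<omega>)) ^ 4 \<le> 8 * (?a ^ 4 * ?y ^ 4) + 8 * (- dot p x \<beta>) ^ 4"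
      using power4_add_le[of "?a * ?y" "- dot p x \<beta>"] dot_score[OF i \<omega>, of x] by (simp add: power_mult_distrib)
    ultimately show "(dot p x (score i \<omega>)) ^ 4 \<le> ?b \<omega>" using c by linarith
  qed
  also have "expectation ?b = 4 * (?s / ?q)\<^sup>2 * (105 * ?q ^ 4)
      + 4 * (?q / ?s)\<^sup>2 * expectation (\<lambda>\<omega>. (proj i \<beta> \<omega> + \<epsilon> i \<omega>) ^ 8) + 8 * (?q * ?s)\<^sup>2"
    using ip iy by (simp add: proj_eighth[OF i] prob_space)
  also have "\<dots> \<le> 4 * (?s / ?q)\<^sup>2 * (105 * ?q ^ 4) + 4 * (?q / ?s)\<^sup>2 * (13440 * ?s ^ 4) + 8 * (?q * ?s)\<^sup>2"
    by (intro add_mono mult_left_mono response_eighth(2)[OF i] order_refl) auto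
  also have "\<dots> = 54188 * (?q * ?s)\<^sup>2"
  proof -
    have "(u / v)\<^sup>2 * (k * v ^ 4) = k * (v * u)\<^sup>2" if "0 < v" for u v k :: real
      using that by (simp add: power_divide power_mult_distrib power2_eq_square power4_eq_xxxx)
    from this[OF q, of ?s 105] this[OF s, of ?q 13440] show ?thesis
      by (simp only: mult.assoc) (simp add: mult.commute[of ?s ?q])
  qed
  also have "\<dots> \<le> 55000 * ?s\<^sup>2 * ?q\<^sup>2" by (simp add: power_mult_distrib mult_ac)
  finally show ?thesis .
qed

lemma score_sample: "score_sample M n p score \<beta> (\<sigma>\<^sup>2 + dot p \<beta> \<beta>) 55000"
proof
  show "indep_vars (\<lambda>_. vec_space p) score {..<n}" by (rule score_indep)
  show "dot p \<beta> \<beta> \<le> \<sigma>\<^sup>2 + dot p \<beta> \<beta>" by simp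
qed (use noise_or_signal p_ge in \<open>simp_all add: score_L4 score_mean score_second score_fourth\<close>)

end

section \<open>The naive estimator\<close>

lemma sum_pairs: "(\<Sum>b<n. \<Sum>a<b. x a + x b) = (real n - 1) * (\<Sum>b<n. x b :: real)"
  by (induction n) (auto simp: sum.distrib algebra_simps)

lemma real_choose_two: "real (n choose 2) = real n * (real n - 1) / 2"
  by (induction n) (auto simp: numeral_2_eq_2 field_simps)

lemma dot_sum_left: "dot p (\<lambda>j. \<Sum>a\<in>A. f a j) z = (\<Sum>a\<in>A. dot p (f a) z)"
  unfolding dot_def sum_distrib_right by (rule sum.swap)

text \<open>The algebraic identity behind the martingale. In the sum over pairs each \<open>\<beta>\<^sup>T w\<^sub>b\<close> occurs
  \<open>n - 1\<close> times, once for every other observation; attributing all of them to the time \<open>b\<close> itself turns them into a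
  drift of the walk.\<close>

lemma pairwise_dot_centering:
  fixes W :: "nat \<Rightarrow> nat \<Rightarrow> real" and \<beta> :: "nat \<Rightarrow> real"
  defines "w \<equiv> \<lambda>i j. W i j - \<beta> j"
  shows "(\<Sum>b<n. \<Sum>a<b. dot p (W a) (W b)) =
    (\<Sum>b<n. dot p (\<lambda>j. (\<Sum>a<b. w a j) + (real n - 1) * \<beta> j) (w b)) + real (n choose 2) * dot p \<beta> \<beta>"
proof -
  have W: "W i = (\<lambda>j. w i j + \<beta> j)" for i by (simp add: w_def)
  have "dot p (W a) (W b) = dot p (w a) (w b) + (dot p \<beta> (w a) + dot p \<beta> (w b)) + dot p \<beta> \<beta>" for a b
    unfolding W dot_add_left dot_add_right dot_commute[of p "w a" \<beta>] by simp
  then have "(\<Sum>b<n. \<Sum>a<b. dot p (W a) (W b)) = (\<Sum>b<n. \<Sum>a<b. dot p (w a) (w b))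
      + (\<Sum>b<n. \<Sum>a<b. dot p \<beta> (w a) + dot p \<beta> (w b)) + (\<Sum>b<n. real b) * dot p \<beta> \<beta>"
    by (simp add: sum.distrib sum_distrib_right)
  also have "(\<Sum>b<n. real b) = real (n choose 2)"
    unfolding real_choose_two by (induction n) (auto simp: field_simps)
  also have "(\<Sum>b<n. \<Sum>a<b. dot p (w a) (w b)) + (\<Sum>b<n. \<Sum>a<b. dot p \<beta> (w a) + dot p \<beta> (w b))
      = (\<Sum>b<n. dot p (\<lambda>j. (\<Sum>a<b. w a j) + (real n - 1) * \<beta> j) (w b))"
    unfolding sum_pairs by (simp add: dot_add_left dot_scale_left dot_sum_left sum.distrib sum_distrib_left)
  finally show ?thesis .
qed

lemma signal_eq_dot: "signal p \<beta> = dot p \<beta> \<beta>"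
  by (simp add: signal_def dot_def power2_eq_square)

context gaussian_linear_model
begin

text \<open>The estimate of \<open>char_near_normal\<close> for the standardised estimator, with the absolute constant 55000 of the fourth
  moment bound for the scores.\<close>

lemma naive_estimator_char_near_normal:
  assumes n: "2 \<le> n" and pos: "0 < \<psi>"
    and sq: "\<psi>\<^sup>2 = 2 * ((1 + real p / real n) * (\<sigma>\<^sup>2 + signal p \<beta>)\<^sup>2 - \<sigma> ^ 4 + 3 * (signal p \<beta>)\<^sup>2)"
  shows "cmod (char (distr M borel (\<lambda>\<omega>. sqrt (real n) * ((naive_estimator n p X Y \<omega> - signal p \<beta>) / \<psi>))) u
      - of_real (exp (- (u\<^sup>2 / 2))))
    \<le> 32 * 55000 * u\<^sup>2 * (1 / sqrt (real p) + 1 / sqrt (real n)) + 7000 * 55000\<^sup>2 * \<bar>u\<bar> ^ 3 / sqrt (real n)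
      + 13 * u ^ 4 / real n + u\<^sup>2 / real n"
proof -
  let ?s = "\<sigma>\<^sup>2 + dot p \<beta> \<beta>" and ?t = "dot p \<beta> \<beta>"
  interpret w: score_sample M n p score \<beta> ?s 55000 by (rule score_sample)
  interpret w: scaled_score_sample M n p score \<beta> ?s 55000 \<psi>
  proof
    show "\<psi>\<^sup>2 = 2 * ?s\<^sup>2 * real p / real n + 4 * (?s * ?t + ?t\<^sup>2)"
      unfolding sq signal_eq_dot by (simp add: power2_eq_square power4_eq_xxxx algebra_simps add_divide_distrib)
  qed fact+
  have eq: "sqrt (real n) * ((naive_estimator n p X Y \<omega> - signal p \<beta>) / \<psi>) = (\<Sum>b<n. w.D b \<omega>)"
    if "\<omega> \<in> space M" for \<omega>
  proof -
    define W where "W i j = X i j \<omega> * Y i \<omega>" for i j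
    let ?A = "\<lambda>b. dot p (\<lambda>j. (\<Sum>a<b. W a j - \<beta> j) + (real n - 1) * \<beta> j) (\<lambda>j. W b j - \<beta> j)"
    have "w.D b \<omega> = w.\<kappa> * ?A b" for b
    proof -
      have "dot p (w.drifted_walk b (w.past b \<omega>)) (score b \<omega>) = ?A b"
        unfolding dot_def
      proof (intro sum.cong refl)
        fix j assume "j \<in> {..<p}"
        then show "w.drifted_walk b (w.past b \<omega>) j * score b \<omega> j = ((\<Sum>a<b. W a j - \<beta> j) + (real n - 1) * \<beta> j) * (W b j - \<beta> j)"
          by (simp add: w.drifted_walk_def w.psum_past w.N_def score_def W_def)
      qed
      then show ?thesis by (simp add: w.D_def)
    qed
    then have "(\<Sum>b<n. w.D b \<omega>) = w.\<kappa> * (\<Sum>b<n. ?A b)" by (simp add: sum_distrib_left)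
    also have "(\<Sum>b<n. ?A b) = real (n choose 2) * (naive_estimator n p X Y \<omega> - signal p \<beta>)"
    proof -
      have "real (n choose 2) * naive_estimator n p X Y \<omega> = (\<Sum>b<n. \<Sum>a<b. dot p (W a) (W b))"
        using n by (simp add: naive_estimator_def Let_def W_def dot_def binomial_eq_0_iff)
      then show ?thesis
        unfolding pairwise_dot_centering[of _ _ _ \<beta>] signal_eq_dot by (simp add: right_diff_distrib)
    qed
    also have "w.\<kappa> * (real (n choose 2) * (naive_estimator n p X Y \<omega> - signal p \<beta>))
        = (w.\<kappa> * real (n choose 2)) * (naive_estimator n p X Y \<omega> - signal p \<beta>)" by simp
    also have "w.\<kappa> * real (n choose 2) = sqrt (real n) / \<psi>"
    proof -
      have "sqrt (real n) * sqrt (real n) = real n" by simp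
      then show ?thesis
        unfolding w.\<kappa>_def real_choose_two w.N_def[symmetric] using w.N_pos w.n_pos pos by (simp add: field_simps)
    qed
    finally show ?thesis by simp
  qed
  have "char (distr M borel (\<lambda>\<omega>. sqrt (real n) * ((naive_estimator n p X Y \<omega> - signal p \<beta>) / \<psi>))) u
     = expectation (\<lambda>\<omega>. iexp (u * (sqrt (real n) * ((naive_estimator n p X Y \<omega> - signal p \<beta>) / \<psi>))))"
    unfolding char_def using naive_estimator_measurable by (subst integral_distr) auto
  also have "\<dots> = expectation (\<lambda>\<omega>. iexp (u * (\<Sum>b<n. w.D b \<omega>)))"
    by (intro Bochner_Integration.integral_cong refl) (simp only: eq)
  finally show ?thesis using w.char_near_normal[of u] by simp
qed

end

theorem corollary2p1:
  fixes M :: "nat \<Rightarrow> 'a measure"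
    and p :: "nat \<Rightarrow> nat"
    and X :: "nat \<Rightarrow> nat \<Rightarrow> nat \<Rightarrow> 'a \<Rightarrow> real"
    and Y \<epsilon> :: "nat \<Rightarrow> nat \<Rightarrow> 'a \<Rightarrow> real"
    and \<beta> :: "nat \<Rightarrow> nat \<Rightarrow> real"
    and \<sigma> \<tau>2 \<psi> :: "nat \<Rightarrow> real"
    and c :: real
  assumes model: "\<And>n. linear_model (M n) n (p n) (X n) (Y n) (\<epsilon> n) (\<beta> n) (\<sigma> n)"
    and tau2: "\<And>n. \<tau>2 n = signal (p n) (\<beta> n)"
    and X_normal: "\<And>n i. i < n \<Longrightarrow>
      distr (M n) (vec_space (p n)) (covariates (p n) (X n) i) = std_normal_vec (p n)"
    and error_normal: "\<And>n i. i < n \<Longrightarrow> distr (M n) borel (\<epsilon> n i) = normal_law (\<sigma> n)"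
    and bounded: "bounded (range (\<lambda>n. \<tau>2 n + (\<sigma> n)\<^sup>2))"
    and p_infinity: "filterlim p at_top sequentially"
    and ratio: "(\<lambda>n. real (p n) / real n) \<longlonglongrightarrow> c"
    and psi_pos: "\<And>n. n \<ge> 2 \<Longrightarrow> \<psi> n > 0"
    and psi: "\<And>n. n \<ge> 2 \<Longrightarrow>
      (\<psi> n)\<^sup>2 = 2 * ((1 + real (p n) / real n) * ((\<sigma> n)\<^sup>2 + \<tau>2 n)\<^sup>2 - (\<sigma> n) ^ 4 + 3 * (\<tau>2 n)\<^sup>2)"
  shows "weak_conv_m
    (\<lambda>n. distr (M n) borel
       (\<lambda>\<omega>. sqrt (real n) * ((naive_estimator n (p n) (X n) (Y n) \<omega> - \<tau>2 n) / \<psi> n)))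
    std_normal_distribution"
proof (rule levy_continuity)
  let ?Z = "\<lambda>n \<omega>. sqrt (real n) * ((naive_estimator n (p n) (X n) (Y n) \<omega> - \<tau>2 n) / \<psi> n)"
  show "real_distribution (distr (M n) borel (?Z n))" for n
  proof -
    interpret linear_model "M n" n "p n" "X n" "Y n" "\<epsilon> n" "\<beta> n" "\<sigma> n" by (rule model)
    show ?thesis using naive_estimator_measurable by (intro real_distribution_distr) simp
  qed
  show "real_distribution std_normal_distribution" by (rule real_dist_normal_dist)
  fix u :: real
  let ?b = "\<lambda>n. 32 * 55000 * u\<^sup>2 * (1 / sqrt (real (p n)) + 1 / sqrt (real n))
    + 7000 * 55000\<^sup>2 * \<bar>u\<bar> ^ 3 / sqrt (real n) + 13 * u ^ 4 / real n + u\<^sup>2 / real n"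
  have bound: "cmod (char (distr (M n) borel (?Z n)) u - of_real (exp (- (u\<^sup>2 / 2)))) \<le> ?b n"
    if n: "2 \<le> n" and p: "1 \<le> p n" for n
  proof -
    \<comment> \<open>Positivity of \<open>\<psi>\<close> excludes the degenerate model.\<close>
    have "0 < (\<sigma> n)\<^sup>2 + dot (p n) (\<beta> n) (\<beta> n)"
    proof (rule ccontr)
      assume "\<not> 0 < (\<sigma> n)\<^sup>2 + dot (p n) (\<beta> n) (\<beta> n)"
      then have "\<sigma> n = 0" "dot (p n) (\<beta> n) (\<beta> n) = 0"
        using dot_self_nonneg[of "p n" "\<beta> n"] zero_le_power2[of "\<sigma> n"]
        by (auto simp: not_less add_nonneg_eq_0_iff dest!: antisym[of _ 0])
      then have "(\<psi> n)\<^sup>2 = 0" using psi[OF n] by (simp add: tau2 signal_eq_dot)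
      then show False using psi_pos[OF n] by simp
    qed
    then have "gaussian_linear_model (M n) n (p n) (X n) (Y n) (\<epsilon> n) (\<beta> n) (\<sigma> n)"
      using model[of n] X_normal[of _ n] error_normal[of _ n] p
      by (simp add: gaussian_linear_model_def gaussian_linear_model_axioms_def)
    from gaussian_linear_model.naive_estimator_char_near_normal[OF this n psi_pos[OF n]] psi[OF n]
    show ?thesis by (simp only: tau2)
  qed
  \<comment> \<open>It remains to see that the explicit bound vanishes as \<open>n\<close> and \<open>p\<close> grow.\<close>
  have "filterlim (\<lambda>n. sqrt (real (p n))) at_top sequentially"
    by (intro filterlim_compose[OF sqrt_at_top] filterlim_compose[OF filterlim_real_sequentially p_infinity])
  then have p0: "(\<lambda>n. 1 / sqrt (real (p n))) \<longlonglongrightarrow> 0"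
    using tendsto_inverse_0_at_top by (simp add: inverse_eq_divide)
  have "filterlim (\<lambda>n. sqrt (real n)) at_top sequentially"
    by (intro filterlim_compose[OF sqrt_at_top] filterlim_real_sequentially)
  then have n0: "(\<lambda>n. 1 / sqrt (real n)) \<longlonglongrightarrow> 0"
    using tendsto_inverse_0_at_top by (simp add: inverse_eq_divide)
  have "(\<lambda>n. 32 * 55000 * u\<^sup>2 * (1 / sqrt (real (p n)) + 1 / sqrt (real n))
      + 7000 * 55000\<^sup>2 * \<bar>u\<bar> ^ 3 * (1 / sqrt (real n)) + 13 * u ^ 4 * (1 / real n) + u\<^sup>2 * (1 / real n))
    \<longlonglongrightarrow> 32 * 55000 * u\<^sup>2 * (0 + 0) + 7000 * 55000\<^sup>2 * \<bar>u\<bar> ^ 3 * 0 + 13 * u ^ 4 * 0 + u\<^sup>2 * 0"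
    by (intro tendsto_add tendsto_mult tendsto_const p0 n0 lim_1_over_n)
  then have b0: "?b \<longlonglongrightarrow> 0" by simp
  have "eventually (\<lambda>n. 2 \<le> n) sequentially" by (rule eventually_ge_at_top)
  moreover have "eventually (\<lambda>n. 1 \<le> p n) sequentially"
    using p_infinity by (simp add: filterlim_at_top)
  ultimately have "eventually (\<lambda>n. cmod (char (distr (M n) borel (?Z n)) u - of_real (exp (- (u\<^sup>2 / 2)))) \<le> ?b n) sequentially"
    by eventually_elim (rule bound)
  then have "(\<lambda>n. char (distr (M n) borel (?Z n)) u - of_real (exp (- (u\<^sup>2 / 2)))) \<longlonglongrightarrow> 0"
    by (rule Lim_null_comparison) (rule b0)
  then show "(\<lambda>n. char (distr (M n) borel (?Z n)) u) \<longlonglongrightarrow> char std_normal_distribution u"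
    unfolding char_std_normal_distribution LIM_zero_iff by simp
qed

end
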